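(* Let $\mu=\mathcal{N}(0,\Sigma_\mu)\in\mathcal{P}(\mathbb{R}^p)$ and $\nu=\mathcal{N}(0,\Sigma_\nu)\in\mathcal{P}(\mathbb{R}^q)$ be Gaussian measures, centered without loss of generality. Let $\Sigma_\mu=\mathbf{V}_\mu\mathbf{D}_\mu\mathbf{V}_\mu^\top$ and $\Sigma_\nu=\mathbf{V}_\nu\mathbf{D}_\nu\mathbf{V}_\nu^\top$ be the (orthogonal) diagonalizations of the covariance matrices such that the eigenvalues in $\mathbf{D}_\mu$ and $\mathbf{D}_\nu$ are ordered nondecreasing. (i) When $p\ne q$, $$LGM_2^2(\mu,\nu)=4(\mathrm{tr}\,\Sigma_\mu-\mathrm{tr}\,\Sigma_\nu)^2+8\big(\mathrm{tr}(\Sigma_\mu\Sigma_\mu)+\mathrm{tr}(\Sigma_\nu\Sigma_\nu)\big)+16\min_{\mathbf{B}\in\mathbb{V}_p(\mathbb{R}^q)}-\mathrm{tr}(\mathbf{D}_\mu\mathbf{B}^\top\mathbf{D}_\nu\mathbf{B}).$$ (ii) When $p=q$, an optimal linear Monge map is given by $T(\mathbf{x})=\mathbf{A}\mathbf{x}$ where $$\mathbf{A}=\mathbf{V}_\nu\mathbf{D}_\nu^{1/2}\mathbf{D}_\mu^{-1/2}\mathbf{V}_\mu^\top=\Sigma_\nu^{1/2}\mathbf{V}_\nu\mathbf{V}_\mu^\top\Sigma_\mu^{-1/2},$$ so that $$LGM_2^2(\mu,\nu)=4(\mathrm{tr}\,\Sigma_\mu-\mathrm{tr}\,\Sigma_\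nu)^2+8\big(\mathrm{tr}(\Sigma_\mu\Sigma_\mu)+\mathrm{tr}(\Sigma_\nu\Sigma_\nu)\big)-16\,\mathrm{tr}(\mathbf{D}_\mu\mathbf{D}_\nu).$$
   Context: The linear Gromov-Monge problem between $\mu\in\mathcal{P}(\mathbb{R}^p)$ and $\nu\in\mathcal{P}(\mathbb{R}^q)$ is $$LGM_2^2(\mu,\nu)=\inf_{\substack{T\#\mu=\nu\\ T:\mathbb{R}^p\to\mathbb{R}^q\text{ linear}}}\iint\big(\|\mathbf{x}-\mathbf{x}'\|_2^2-\|T(\mathbf{x})-T(\mathbf{x}')\|_2^2\big)^2d\mu(\mathbf{x})\,d\mu(\mathbf{x}'),$$ where $\#$ is push-forward. $\mathbb{V}_p(\mathbb{R}^q)=\{\mathbf{B}\in\mathbb{R}^{q\times p}:\mathbf{B}^\top\mathbf{B}=\mathbf{I}_p\}$ is the Stiefel manifold. $\mathcal{N}(0,\Sigma)$ is the centered Gaussian measure with covariance $\Sigma$.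
   Formalization: In (i), a linear map pushing μ to ν is assumed to exist (for p>q, Σ_μ invertible also suffices), else LGM is infinite; for p>q the Stiefel set V_p(R^q) is empty and is replaced by BB^T=I_q; in (ii), Σ_μ is assumed invertible so that A is defined. *)

theory Defs
  imports "HOL-Probability.Probability"
begin

text \<open>A matrix of type \<open>real^'p^'q\<close> has rows indexed by \<open>'q\<close> and columns indexed by \<open>'p\<close>,
  i.e. it is a \<open>q \<times> p\<close> matrix acting from \<open>real^'p\<close> to \<open>real^'q\<close>.\<close>

definition psd_matrix :: "real^'n^'n \<Rightarrow> bool" where
  "psd_matrix S \<longleftrightarrow> transpose S = S \<and> (\<forall>x. 0 \<le> x \<bullet> (S *v x))"

definition diagonal_matrix :: "real^'n^'n \<Rightarrow> bool" where
  "diagonal_matrix D \<longleftrightarrow> (\<forall>i j. i \<noteq> j \<longrightarrow> D $ i $ j = 0)"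

text \<open>The principal square root \<open>S^(1/2)\<close>; it exists and is unique when \<open>S\<close> is positive semidefinite.\<close>

definition matrix_sqrt :: "real^'n^'n \<Rightarrow> real^'n^'n" where
  "matrix_sqrt S = (THE R. psd_matrix R \<and> R ** R = S)"

abbreviation matrix_inv_sqrt :: "real^'n^'n \<Rightarrow> real^'n^'n" where
  "matrix_inv_sqrt S \<equiv> matrix_inv (matrix_sqrt S)"

definition ordered_diagonalization ::
    "real^('n::{finite,linorder})^('n::{finite,linorder}) \<Rightarrow> real^('n::{finite,linorder})^('n::{finite,linorder})
      \<Rightarrow> real^('n::{finite,linorder})^('n::{finite,linorder}) \<Rightarrow> bool" where
  "ordered_diagonalization S V D \<longleftrightarrow>
     orthogonal_matrix V \<and> diagonal_matrix D \<and> S = V ** D ** transpose V \<and>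
     (\<forall>i j. i \<le> j \<longrightarrow> D $ i $ i \<le> D $ j $ j)"

definition stiefel :: "(real^'p^'q) set" where
  "stiefel = {B. transpose B ** B = mat 1}"

definition std_gaussian :: "(real^'n) measure" where
  "std_gaussian = density lborel (\<lambda>x. ennreal (\<Prod>i\<in>UNIV. std_normal_density (x $ i)))"

text \<open>\<open>N(0, S)\<close> is the law of \<open>S^(1/2) Z\<close> with \<open>Z\<close> standard Gaussian.  A singular \<open>S\<close> is allowed, in
  which case there is no density with respect to Lebesgue measure.\<close>

definition gaussian_measure :: "real^'n^'n \<Rightarrow> (real^'n) measure" where
  "gaussian_measure S = distr std_gaussian borel (\<lambda>z. matrix_sqrt S *v z)"

definition linear_monge_maps ::
    "(real^'p) measure \<Rightarrow> (real^'q) measure \<Rightarrow> (real^'p \<Rightarrow> real^'q) set" where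
  "linear_monge_maps \<mu> \<nu> = {T. linear T \<and> distr \<mu> borel T = \<nu>}"

text \<open>Cost and infimum are extended reals: the cost is a nonnegative integral, and the infimum is
  \<open>\<infinity>\<close> if there is no linear map pushing \<open>\<mu>\<close> to \<open>\<nu>\<close>.  (With values in \<open>ennreal\<close>, negative real
  numbers would be truncated when compared with the infimum.)\<close>

definition gm_cost :: "(real^'p) measure \<Rightarrow> (real^'p \<Rightarrow> real^'q) \<Rightarrow> ereal" where
  "gm_cost \<mu> T = enn2ereal
     (\<integral>\<^sup>+ x. \<integral>\<^sup>+ x'. ennreal (((norm (x - x'))\<^sup>2 - (norm (T x - T x'))\<^sup>2)\<^sup>2) \<partial>\<mu> \<partial>\<mu>)"

definition LGM2_sq :: "(real^'p) measure \<Rightarrow> (real^'q) measure \<Rightarrow> ereal" where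
  "LGM2_sq \<mu> \<nu> = (INF T\<in>linear_monge_maps \<mu> \<nu>. gm_cost \<mu> T)"

definition optimal_linear_monge_map ::
    "(real^'p) measure \<Rightarrow> (real^'q) measure \<Rightarrow> (real^'p \<Rightarrow> real^'q) \<Rightarrow> bool" where
  "optimal_linear_monge_map \<mu> \<nu> T \<longleftrightarrow>
     T \<in> linear_monge_maps \<mu> \<nu> \<and> gm_cost \<mu> T = LGM2_sq \<mu> \<nu>"

end

theory Submission
  imports Defs
begin

text \<open>For \<open>T = A x\<close> the difference \<open>z - z'\<close> of two independent samples is Gaussian, so Isserlis' formula turns
  the cost into \<open>4 (tr N)^2 + 8 tr (N N)\<close> with \<open>N = S - C^T C\<close> and \<open>C = A S^(1/2)\<close>. On feasible maps
  \<open>C C^T = S'\<close>, so everything is fixed except \<open>- 16 tr (A S S A^T)\<close>. In eigenbases, with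
  \<open>G = V'^T A V\<close> and \<open>G D G^T = D'\<close>, the trace is an assignment value
  \<open>\<Sum> W j i * D i i * D' j j\<close>, and Bessel's inequality makes \<open>W\<close> doubly substochastic; hence it is at
  most the value of matching the ordered eigenvalues from the top. The same bound applies to the squared
  entries of a Stiefel matrix, where the rectangular identity matrix attains it. The matching is realised
  by an explicit \<open>A\<close>: comparing ranks, feasibility forces every nonzero eigenvalue of \<open>S'\<close> to be matched
  with a nonzero eigenvalue of \<open>S\<close>, and rotation invariance of the standard Gaussian gives the
  push-forward condition without any uniqueness theorem for Gaussian laws.\<close>

section \<open>The standard Gaussian measure\<close>

text \<open>The Stiefel problem comes from the substitution \<open>B = E^(-1/2) G D^(1/2)\<close>,
  where \<open>E\<close> stands for the diagonal matrix \<open>D'\<close>: for invertible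
  \<open>E\<close>, feasibility becomes \<open>B B^T = 1\<close> and the trace becomes
  \<open>tr (D B^T E B)\<close>. It gives no bijection between feasible maps and Stiefel matrices
  once eigenvalues vanish. For p < q this is unavoidable: a feasible map forces \<open>E\<close> to
  have rank at most p, so \<open>E\<close> is singular, \<open>B\<close> has zero rows and
  \<open>B^T B = 1\<close> can fail. The two problems are therefore never identified with each
  other. Only entrywise squares are compared: both families lie among the doubly substochastic
  weights, where the objective is linear, and each family attains the same maximum by a matrix of
  its own. Substochastic rather than stochastic weights absorb both the difference in size and the
  zero eigenvalues.\<close>

lemma prod_Basis_cart: "(\<Prod>b\<in>(Basis :: (real^'n) set). f b) = (\<Prod>i\<in>UNIV. f (axis i 1))"
proof -
  have "(Basis :: (real^'n) set) = range (\<lambda>i. axis i 1)"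
    by (auto simp: Basis_vec_def)
  moreover have "prod f (range (\<lambda>i. axis i 1 :: real^'n)) = (\<Prod>i\<in>UNIV. f (axis i 1))"
    by (subst prod.reindex) (auto simp: inj_on_def axis_eq_axis)
  ultimately show ?thesis by simp
qed

lemma measurable_vec_lambda:
  assumes "\<And>i. (\<lambda>x. f x i) \<in> borel_measurable M"
  shows "(\<lambda>x. (\<chi> i. f x i) :: real^'n) \<in> borel_measurable M"
  by (subst borel_measurable_euclidean_space) (auto simp: Basis_vec_def inner_axis assms)

lemma measurable_vec_nth [measurable]: "(\<lambda>x::real^'n. x $ i) \<in> borel_measurable borel"
  by (intro borel_measurable_continuous_onI continuous_intros)

lemma measurable_matrix_vector_mult [measurable]:
  "(\<lambda>x. (A::real^'n^'m) *v x) \<in> borel_measurable borel"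
  by (intro borel_measurable_continuous_onI linear_continuous_on)
    (simp add: matrix_vector_mul_bounded_linear)

text \<open>Lebesgue measure is determined by its values on boxes, and a box pulls back to a product
  of intervals.\<close>

lemma lborel_cart_eq_PiM:
  "(lborel :: (real^'n) measure) = distr (\<Pi>\<^sub>M i\<in>UNIV. lborel) borel (\<lambda>\<omega>. \<chi> i. \<omega> i)"
proof (rule lborel_eqI)
  interpret product_sigma_finite "\<lambda>i::'n. lborel :: real measure" by standard
  have m: "(\<lambda>\<omega>. \<chi> i. \<omega> i) \<in> (\<Pi>\<^sub>M i\<in>UNIV. lborel) \<rightarrow>\<^sub>M (borel :: (real^'n) measure)"
    by (rule measurable_vec_lambda) measurable
  fix l u :: "real^'n"
  assume le: "\<And>b. b \<in> Basis \<Longrightarrow> l \<bullet> b \<le> u \<bullet> b"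
  have le': "l $ i \<le> u $ i" for i
    using le[of "axis i 1"] by (simp add: inner_axis)
  have "(\<lambda>\<omega>. \<chi> i. \<omega> i) -` box l u \<inter> space (\<Pi>\<^sub>M i\<in>(UNIV::'n set). lborel)
     = (\<Pi>\<^sub>E i\<in>UNIV. {l $ i <..< u $ i})"
    by (auto simp: space_PiM mem_box_cart PiE_iff)
  then show "emeasure (distr (\<Pi>\<^sub>M i\<in>UNIV. lborel) borel (\<lambda>\<omega>. \<chi> i. \<omega> i)) (box l u) =
      (\<Prod>b\<in>Basis. (u - l) \<bullet> b)"
    by (simp add: emeasure_distr[OF m] emeasure_PiM prod_Basis_cart inner_axis le' prod_ennreal)
qed simp

text \<open>A product measure is determined by its values on rectangles, where density and indicator
  both factor. This turns the joint density of \<open>std_gaussian\<close> into independence of the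
  coordinates.\<close>

lemma density_PiM:
  fixes f :: "'i \<Rightarrow> 'a \<Rightarrow> ennreal"
  assumes "finite I" and M: "product_sigma_finite M"
    and N: "product_sigma_finite (\<lambda>i. density (M i) (f i))"
    and f [measurable]: "\<And>i. f i \<in> borel_measurable (M i)"
  shows "density (PiM I M) (\<lambda>x. \<Prod>i\<in>I. f i (x i)) = PiM I (\<lambda>i. density (M i) (f i))"
proof -
  interpret M: product_sigma_finite M by fact
  interpret N: product_sigma_finite "\<lambda>i. density (M i) (f i)" by fact
  show ?thesis
  proof (rule N.PiM_eqI)
    show "sets (density (PiM I M) (\<lambda>x. \<Prod>i\<in>I. f i (x i))) = sets (PiM I (\<lambda>i. density (M i) (f i)))"
      by (auto intro!: sets_PiM_cong)
    fix A assume "\<And>i. i \<in> I \<Longrightarrow> A i \<in> sets (density (M i) (f i))"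
    then have A: "\<And>i. i \<in> I \<Longrightarrow> A i \<in> sets (M i)" by simp
    have "emeasure (density (PiM I M) (\<lambda>x. \<Prod>i\<in>I. f i (x i))) (Pi\<^sub>E I A)
        = (\<integral>\<^sup>+x. (\<Prod>i\<in>I. f i (x i)) * indicator (Pi\<^sub>E I A) x \<partial>PiM I M)"
      using A \<open>finite I\<close> by (subst emeasure_density) auto
    also have "\<dots> = (\<integral>\<^sup>+x. (\<Prod>i\<in>I. f i (x i) * indicator (A i) (x i)) \<partial>PiM I M)"
      using \<open>finite I\<close>
      by (intro nn_integral_cong)
        (auto simp: prod.distrib space_PiM PiE_iff indicator_def intro!: prod_zero)
    also have "\<dots> = (\<Prod>i\<in>I. \<integral>\<^sup>+x. f i x * indicator (A i) x \<partial>M i)"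
      using A \<open>finite I\<close> by (intro M.product_nn_integral_prod) auto
    also have "\<dots> = (\<Prod>i\<in>I. emeasure (density (M i) (f i)) (A i))"
      using A by (intro prod.cong refl) (simp add: emeasure_density)
    finally show "emeasure (density (PiM I M) (\<lambda>x. \<Prod>i\<in>I. f i (x i))) (Pi\<^sub>E I A) =
      (\<Prod>i\<in>I. emeasure (density (M i) (f i)) (A i))" .
  qed fact
qed

lemma product_sigma_finite_std_normal: "product_sigma_finite (\<lambda>i. std_normal_distribution)"
proof -
  interpret prob_space std_normal_distribution
    by (rule prob_space_normal_density) simp
  show ?thesis by (simp add: product_sigma_finite_def sigma_finite_measure_axioms)
qed

lemma std_gaussian_eq_PiM:
  "(std_gaussian :: (real^'n) measure) =
    distr (\<Pi>\<^sub>M i\<in>UNIV. std_normal_distribution) borel (\<lambda>\<omega>. \<chi> i. \<omega> i)"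
proof -
  interpret product_sigma_finite "\<lambda>i::'n. lborel :: real measure" by standard
  have m: "(\<lambda>\<omega>. \<chi> i. \<omega> i) \<in> (\<Pi>\<^sub>M i\<in>UNIV. lborel) \<rightarrow>\<^sub>M (borel :: (real^'n) measure)"
    by (rule measurable_vec_lambda) measurable
  have "(std_gaussian :: (real^'n) measure) =
      distr (density (\<Pi>\<^sub>M i\<in>UNIV. lborel) (\<lambda>\<omega>. \<Prod>i\<in>UNIV. ennreal (std_normal_density (\<omega> i))))
        borel (\<lambda>\<omega>. \<chi> i. \<omega> i)"
    unfolding std_gaussian_def lborel_cart_eq_PiM
    by (subst density_distr[OF _ m]) (auto simp: prod_ennreal)
  then show ?thesis
    by (subst (asm) density_PiM) (auto intro: product_sigma_finite_std_normal product_sigma_finite_axioms)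
qed

lemma sets_std_gaussian [measurable_cong, simp]: "sets std_gaussian = sets borel"
  by (simp add: std_gaussian_def)

lemma space_std_gaussian [simp]: "space std_gaussian = UNIV"
  by (simp add: std_gaussian_def)

lemma prob_space_std_gaussian: "prob_space (std_gaussian :: (real^'n) measure)"
proof -
  have "prob_space (\<Pi>\<^sub>M i\<in>(UNIV::'n set). std_normal_distribution)"
    by (intro prob_space_PiM prob_space_normal_density) simp
  moreover have "(\<lambda>\<omega>. \<chi> i. \<omega> i) \<in> (\<Pi>\<^sub>M i\<in>UNIV. std_normal_distribution) \<rightarrow>\<^sub>M (borel :: (real^'n) measure)"
    by (rule measurable_vec_lambda) measurable
  ultimately show ?thesis
    unfolding std_gaussian_eq_PiM by (rule prob_space.prob_space_distr)
qed

section \<open>Moments of coordinate monomials\<close>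

definition std_moment :: "nat \<Rightarrow> real" where
  "std_moment k = (\<integral>x. x ^ k \<partial>std_normal_distribution)"

lemma integrable_std_normal_power: "integrable std_normal_distribution (\<lambda>x. x ^ k)"
  using integrable_std_normal_moment[of k]
  by (subst integrable_density) (auto simp: normal_density_nonneg)

text \<open>The \<open>Suc\<close> form matches exponents that arise by simplifying sums of
  \<open>of_bool\<close> terms.\<close>

lemma std_moment_simps:
  "std_moment 0 = 1" "std_moment (Suc 0) = 0" "std_moment (Suc (Suc 0)) = 1"
  "std_moment (Suc (Suc (Suc 0))) = 0" "std_moment (Suc (Suc (Suc (Suc 0)))) = 3"
proof -
  have e: "std_moment k = (\<integral>x. std_normal_density x * x ^ k \<partial>lborel)" for k
    unfolding std_moment_def by (subst integral_density) (auto simp: normal_density_nonneg)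
  have "std_moment 0 = 1" "std_moment 1 = 0" "std_moment 2 = 1" "std_moment 3 = 0" "std_moment 4 = 3"
    unfolding e
    using integral_std_normal_moment_even[of 0] integral_std_normal_moment_even[of 1]
      integral_std_normal_moment_even[of 2] integral_std_normal_moment_odd[of 0]
      integral_std_normal_moment_odd[of 1]
    by (simp_all add: fact_numeral)
  then show "std_moment 0 = 1" "std_moment (Suc 0) = 0" "std_moment (Suc (Suc 0)) = 1"
      "std_moment (Suc (Suc (Suc 0))) = 0" "std_moment (Suc (Suc (Suc (Suc 0)))) = 3"
    by (simp_all add: eval_nat_numeral)
qed

text \<open>The expectation factors over the coordinates. With an exponent function
  \<open>k\<close>, coinciding indices in a product such as \<open>z $ i * z $ j\<close> are handled
  by adding exponents.\<close>

lemma has_bochner_integral_std_gaussian_monomial: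
  "has_bochner_integral std_gaussian (\<lambda>z::real^'n. \<Prod>m\<in>UNIV. (z $ m) ^ k m) (\<Prod>m\<in>UNIV. std_moment (k m))"
proof -
  interpret product_sigma_finite "\<lambda>i::'n. std_normal_distribution"
    by (rule product_sigma_finite_std_normal)
  have "(\<lambda>\<omega>. \<chi> i. \<omega> i) \<in> (\<Pi>\<^sub>M i\<in>UNIV. std_normal_distribution) \<rightarrow>\<^sub>M (borel :: (real^'n) measure)"
    by (rule measurable_vec_lambda) measurable
  moreover have "(\<integral>\<omega>. (\<Prod>m\<in>UNIV. (\<omega> m) ^ k m) \<partial>(\<Pi>\<^sub>M i\<in>(UNIV::'n set). std_normal_distribution))
      = (\<Prod>m\<in>UNIV. std_moment (k m))"
    unfolding std_moment_def by (intro product_integral_prod integrable_std_normal_power) simp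
  moreover have "integrable (\<Pi>\<^sub>M i\<in>(UNIV::'n set). std_normal_distribution) (\<lambda>\<omega>. \<Prod>m\<in>UNIV. (\<omega> m) ^ k m)"
    by (intro product_integrable_prod integrable_std_normal_power) simp
  ultimately show ?thesis
    unfolding std_gaussian_eq_PiM has_bochner_integral_iff
    by (auto simp: integrable_distr_eq integral_distr)
qed

text \<open>With \<open>B\<close> the unit ball, Fubini and translation invariance applied to the double integral of
  \<open>indicator A (f x) * indicator B (f x - y)\<close> give
  \<open>emeasure lborel (f -` A) * emeasure lborel B = emeasure lborel A * emeasure lborel (f -` B)\<close>,
  and \<open>f -` B = B\<close>.\<close>

lemma lborel_distr_orthogonal_transformation:
  fixes f :: "'a::euclidean_space \<Rightarrow> 'a"
  assumes f: "orthogonal_transformation f"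
  shows "distr lborel borel f = lborel"
proof (rule measure_eqI)
  have lin: "linear f" using f by (rule orthogonal_transformation_linear)
  have [measurable]: "f \<in> borel_measurable borel"
    using lin by (intro borel_measurable_continuous_onI linear_continuous_on linear_conv_bounded_linear[THEN iffD1])
  \<comment> \<open>A preimage \<open>g y\<close> turns a translation by \<open>y\<close> in the
    target of \<open>f\<close> into a translation in its source.\<close>
  obtain g where g: "\<And>x. f (g x) = x"
    using orthogonal_transformation_surj[OF f] by (metis surjD)
  have shift: "(\<integral>\<^sup>+x. h (x + c) \<partial>lborel) = (\<integral>\<^sup>+x. h x \<partial>lborel)"
    if [measurable]: "h \<in> borel_measurable borel" for h :: "'a \<Rightarrow> ennreal" and c
    using nn_integral_distr[of "(+) c" lborel borel h] by (simp add: lborel_distr_plus add.commute)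
  fix A :: "'a set" assume "A \<in> sets (distr lborel borel f)"
  then have [measurable]: "A \<in> sets borel" by simp
  define B where "B = (ball 0 1 :: 'a set)"
  have [measurable]: "B \<in> sets borel" by (simp add: B_def)
  have B: "indicator B (f x) = (indicator B x :: ennreal)" for x
    using orthogonal_transformation_norm[OF f] by (simp add: B_def indicator_def)
  have "emeasure lborel (f -` A) * emeasure lborel B =
      (\<integral>\<^sup>+x. indicator A (f x) * (\<integral>\<^sup>+y. indicator B (y + - f x) \<partial>lborel) \<partial>lborel)"
  proof -
    have "f -` A \<in> sets borel" using measurable_sets[of f borel borel A] by simp
    then have "emeasure lborel (f -` A) = (\<integral>\<^sup>+x. indicator (f -` A) x \<partial>lborel)" by simp
    also have "\<dots> = (\<integral>\<^sup>+x. indicator A (f x) \<partial>lborel)"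
      by (intro nn_integral_cong) (simp add: indicator_def)
    finally have "emeasure lborel (f -` A) = (\<integral>\<^sup>+x. indicator A (f x) \<partial>lborel)" .
    moreover have "(\<integral>\<^sup>+y. indicator B (y + - f x) \<partial>lborel) = emeasure lborel B" for x
      using shift[of "indicator B" "- f x"] by simp
    ultimately show ?thesis by (simp add: nn_integral_multc)
  qed
  \<comment> \<open>The ball is symmetric about the origin, so it contains \<open>y - f x\<close>
    exactly when it contains \<open>f x - y\<close>.\<close>
  also have "\<dots> = (\<integral>\<^sup>+x. \<integral>\<^sup>+y. indicator A (f x) * indicator B (f x - y) \<partial>lborel \<partial>lborel)"
    by (subst nn_integral_cmult[symmetric])
      (auto intro!: nn_integral_cong simp: B_def indicator_def norm_minus_commute)
  also have "\<dots> = (\<integral>\<^sup>+y. \<integral>\<^sup>+x. indicator A (f x) * indicator B (f x - y) \<partial>lborel \<partial>lborel)"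
    by (intro lborel_pair.Fubini') measurable
  also have "\<dots> = (\<integral>\<^sup>+y. \<integral>\<^sup>+x. indicator A (y + f x) * indicator B (f x) \<partial>lborel \<partial>lborel)"
  proof (rule nn_integral_cong)
    fix y
    have "(\<integral>\<^sup>+x. indicator A (f x) * indicator B (f x - y) \<partial>lborel)
        = (\<integral>\<^sup>+x. indicator A (f (x + g y)) * indicator B (f (x + g y) - y) \<partial>lborel)"
      using shift[of "\<lambda>x. indicator A (f x) * indicator B (f x - y)" "g y"] by simp
    then show "(\<integral>\<^sup>+x. indicator A (f x) * indicator B (f x - y) \<partial>lborel)
        = (\<integral>\<^sup>+x. indicator A (y + f x) * indicator B (f x) \<partial>lborel)"
      by (simp add: linear_add[OF lin] g add.commute)
  qed
  also have "\<dots> = (\<integral>\<^sup>+x. \<integral>\<^sup>+y. indicator A (y + f x) * indicator B (f x) \<partial>lborel \<partial>lborel)"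
    by (intro lborel_pair.Fubini') measurable
  also have "\<dots> = (\<integral>\<^sup>+x. emeasure lborel A * indicator B (f x) \<partial>lborel)"
    by (simp add: nn_integral_multc shift)
  also have "\<dots> = emeasure lborel A * emeasure lborel B"
    by (simp add: nn_integral_cmult B)
  finally have *: "emeasure lborel (f -` A) * emeasure lborel B = emeasure lborel A * emeasure lborel B" .
  have "emeasure lborel B \<noteq> 0"
    unfolding B_def by (metis content_ball_pos zero_less_one emeasure_eq_ennreal_measure measure_def enn2real_0 less_irrefl)
  moreover have "emeasure lborel B \<noteq> \<infinity>"
    unfolding B_def using emeasure_bounded_finite[of "ball (0::'a) 1"] by simp
  ultimately have "emeasure lborel (f -` A) = emeasure lborel A"
    using * by (simp add: mult.commute[of _ "emeasure lborel B"] ennreal_mult_cancel_left)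
  then show "emeasure (distr lborel borel f) A = emeasure lborel A"
    by (simp add: emeasure_distr)
qed simp

section \<open>Rotation invariance and laws of coordinate selections\<close>

text \<open>The product density is radial, hence unchanged by orthogonal maps.\<close>

lemma std_gaussian_density_eq:
  "(\<Prod>i\<in>UNIV. std_normal_density ((x::real^'n) $ i)) = (1 / sqrt (2 * pi)) ^ CARD('n) * exp (- (norm x)\<^sup>2 / 2)"
  by (simp add: normal_density_def prod_dividef prod.distrib power_divide norm_vec_def L2_set_def
      sum_nonneg exp_sum[symmetric] sum_divide_distrib sum_negf)

lemma std_gaussian_rotation:
  fixes V :: "real^'n^'n"
  assumes "orthogonal_matrix V"
  shows "distr std_gaussian borel ((*v) V) = std_gaussian"
proof -
  have V: "orthogonal_transformation ((*v) V)"
    using assms by (simp add: orthogonal_transformation_matrix)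
  have [measurable]: "(\<lambda>x::real^'n. ennreal (\<Prod>i\<in>UNIV. std_normal_density (x $ i))) \<in> borel_measurable borel"
    by measurable
  have "density (distr lborel borel ((*v) V)) (\<lambda>x::real^'n. ennreal (\<Prod>i\<in>UNIV. std_normal_density (x $ i)))
      = distr (density lborel (\<lambda>x. ennreal (\<Prod>i\<in>UNIV. std_normal_density ((V *v x) $ i)))) borel ((*v) V)"
    by (rule density_distr) auto
  then show ?thesis
    by (simp add: std_gaussian_def std_gaussian_density_eq orthogonal_transformation_norm[OF V]
      lborel_distr_orthogonal_transformation[OF V])
qed

text \<open>The right-hand side does not mention \<open>g\<close>, nor the dimension of the source.
  Two selections with the same coefficients \<open>c\<close>, even from spaces of different
  dimension, therefore have the same law. Injectivity is asked only where \<open>c\<close> is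
  nonzero, since the other coordinates of the image are constantly zero.\<close>

lemma std_gaussian_subvector:
  fixes g :: "'q::finite \<Rightarrow> 'p::finite" and c :: "real^'q"
  assumes g: "inj_on g {j. c $ j \<noteq> 0}"
  shows "distr std_gaussian borel (\<lambda>z::real^'p. (\<chi> j. c $ j * z $ g j)) =
    distr (PiM {j. c $ j \<noteq> 0} (\<lambda>i. std_normal_distribution)) borel
      (\<lambda>\<omega>. \<chi> j. c $ j * (if c $ j \<noteq> 0 then \<omega> j else 0))"
proof -
  let ?J = "{j. c $ j \<noteq> 0}"
  let ?N = "\<lambda>i. std_normal_distribution"
  let ?r = "\<lambda>\<omega>. \<lambda>j\<in>?J. \<omega> (g j)"
  let ?F = "\<lambda>\<omega>. \<chi> j. c $ j * (if c $ j \<noteq> 0 then \<omega> j else 0)"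
  have v: "(\<lambda>\<omega>. \<chi> i. \<omega> i) \<in> (\<Pi>\<^sub>M i\<in>UNIV. std_normal_distribution) \<rightarrow>\<^sub>M (borel :: (real^'p) measure)"
    by (rule measurable_vec_lambda) measurable
  have F: "?F \<in> PiM ?J ?N \<rightarrow>\<^sub>M borel"
  proof (rule measurable_vec_lambda)
    show "(\<lambda>\<omega>. c $ j * (if c $ j \<noteq> 0 then \<omega> j else 0)) \<in> borel_measurable (PiM ?J ?N)" for j
      by (cases "c $ j = 0") auto
  qed
  have r: "?r \<in> PiM UNIV ?N \<rightarrow>\<^sub>M PiM ?J ?N"
    by (intro measurable_restrict) auto
  have s: "(\<lambda>z::real^'p. (\<chi> j. c $ j * z $ g j)) \<in> borel_measurable borel"
    by (rule measurable_vec_lambda) measurable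
  have "distr std_gaussian borel (\<lambda>z::real^'p. (\<chi> j. c $ j * z $ g j)) =
      distr (PiM UNIV ?N) borel (\<lambda>\<omega>. \<chi> j. c $ j * \<omega> (g j))"
    unfolding std_gaussian_eq_PiM by (subst distr_distr[OF s v]) (simp add: comp_def)
  also have "\<dots> = distr (PiM UNIV ?N) borel (?F \<circ> ?r)"
    by (rule arg_cong[where f = "distr (PiM UNIV ?N) borel"]) (auto simp: fun_eq_iff vec_eq_iff)
  also have "\<dots> = distr (distr (PiM UNIV ?N) (PiM ?J ?N) ?r) borel ?F"
    by (rule distr_distr[OF F r, symmetric])
  \<comment> \<open>Distinct coordinates of an independent family are again independent with the
    same marginals.\<close>
  also have "distr (PiM UNIV ?N) (PiM ?J ?N) ?r = PiM ?J ?N"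
    using g by (intro distr_PiM_reindex prob_space_normal_density) auto
  finally show ?thesis .
qed

section \<open>Mixed moments up to order four\<close>

lemma std_gaussian_moment1:
  "has_bochner_integral std_gaussian (\<lambda>z::real^'n. z $ i) 0"
proof -
  have "z $ i = (\<Prod>m\<in>UNIV. (z $ m) ^ of_bool (m = i))" for z :: "real^'n"
    by (subst prod.remove[of _ i]) auto
  moreover have "(\<Prod>m\<in>(UNIV::'n set). std_moment (of_bool (m = i))) = 0"
    by (rule prod_zero) (auto simp: std_moment_simps insert_commute intro!: exI[of _ i])
  ultimately show ?thesis
    using has_bochner_integral_std_gaussian_monomial[of "\<lambda>m. of_bool (m = i)"] by (simp only:)
qed

lemma std_gaussian_moment2:
  "has_bochner_integral std_gaussian (\<lambda>z::real^'n. z $ i * z $ j) (of_bool (i = j))"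
proof -
  let ?k = "\<lambda>m. of_bool (m = i) + of_bool (m = j) :: nat"
  have single: "(\<Prod>m\<in>UNIV. (z $ m) ^ of_bool (m = i)) = z $ i" for i and z :: "real^'n"
    by (subst prod.remove[of _ i]) auto
  have "(\<Prod>m\<in>UNIV. (z $ m) ^ ?k m) = z $ i * z $ j" for z :: "real^'n"
    by (simp add: power_add prod.distrib single)
  moreover have "(\<Prod>m\<in>(UNIV::'n set). std_moment (?k m)) = of_bool (i = j)"
  proof -
    have "(\<Prod>m\<in>(UNIV::'n set). std_moment (?k m)) = (\<Prod>m\<in>{i, j}. std_moment (?k m))"
      by (rule prod.mono_neutral_right) (auto simp: std_moment_simps)
    then show ?thesis
      by (cases "i = j") (simp_all add: std_moment_simps insert_commute)
  qed
  ultimately show ?thesis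
    using has_bochner_integral_std_gaussian_monomial[of ?k] by (simp only:)
qed

lemma std_gaussian_moment3:
  "has_bochner_integral std_gaussian (\<lambda>z::real^'n. z $ i * z $ j * z $ k) 0"
proof -
  let ?k = "\<lambda>m. of_bool (m = i) + of_bool (m = j) + of_bool (m = k) :: nat"
  have single: "(\<Prod>m\<in>UNIV. (z $ m) ^ of_bool (m = i)) = z $ i" for i and z :: "real^'n"
    by (subst prod.remove[of _ i]) auto
  have "(\<Prod>m\<in>UNIV. (z $ m) ^ ?k m) = z $ i * z $ j * z $ k" for z :: "real^'n"
    by (simp add: power_add prod.distrib single)
  moreover have "(\<Prod>m\<in>(UNIV::'n set). std_moment (?k m)) = 0"
  proof -
    have "(\<Prod>m\<in>(UNIV::'n set). std_moment (?k m)) = (\<Prod>m\<in>{i, j, k}. std_moment (?k m))"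
      by (rule prod.mono_neutral_right) (auto simp: std_moment_simps)
    then show ?thesis
      by (cases "i = j"; cases "i = k"; cases "j = k") (simp_all add: std_moment_simps insert_commute)
  qed
  ultimately show ?thesis
    using has_bochner_integral_std_gaussian_monomial[of ?k] by (simp only:)
qed

text \<open>Isserlis' formula: the three summands are the three pairings of four indices. When all
  indices agree they add up to 3, the fourth moment.\<close>

lemma std_gaussian_moment4:
  "has_bochner_integral std_gaussian (\<lambda>z::real^'n. (z $ i * z $ j) * (z $ k * z $ l))
    (of_bool (i = j) * of_bool (k = l) + of_bool (i = k) * of_bool (j = l) + of_bool (j = k) * of_bool (i = l))"
    (is "has_bochner_integral _ _ ?v")
proof -
  let ?k = "\<lambda>m. of_bool (m = i) + of_bool (m = j) + of_bool (m = k) + of_bool (m = l) :: nat"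
  have single: "(\<Prod>m\<in>UNIV. (z $ m) ^ of_bool (m = i)) = z $ i" for i and z :: "real^'n"
    by (subst prod.remove[of _ i]) auto
  have "(\<Prod>m\<in>UNIV. (z $ m) ^ ?k m) = (z $ i * z $ j) * (z $ k * z $ l)" for z :: "real^'n"
    by (simp add: power_add prod.distrib single)
  moreover have "(\<Prod>m\<in>(UNIV::'n set). std_moment (?k m)) = ?v"
  proof -
    \<comment> \<open>Every other coordinate has exponent 0 and contributes the factor 1, so
      finitely many coincidence patterns remain.\<close>
    have "(\<Prod>m\<in>(UNIV::'n set). std_moment (?k m)) = (\<Prod>m\<in>{i, j, k, l}. std_moment (?k m))"
      by (rule prod.mono_neutral_right) (auto simp: std_moment_simps)
    then show ?thesis
      by (cases "i = j"; cases "i = k"; cases "j = k"; cases "i = l"; cases "j = l"; cases "k = l")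
        (simp_all add: std_moment_simps insert_commute)
  qed
  ultimately show ?thesis
    using has_bochner_integral_std_gaussian_monomial[of ?k] by (simp only:)
qed

section \<open>Expectations of quadratic forms\<close>

lemma quadratic_form_eq_sum: "(z::real^'n) \<bullet> (N *v z) = (\<Sum>i\<in>UNIV. \<Sum>j\<in>UNIV. N $ i $ j * (z $ i * z $ j))"
  by (simp add: inner_vec_def matrix_vector_mult_def sum_distrib_left mult_ac)

lemma of_bool_sum_delta:
  fixes f :: "'n::finite \<Rightarrow> 'a::semiring_1"
  shows "(\<Sum>j\<in>UNIV. f j * of_bool (i = j)) = f i" "(\<Sum>j\<in>UNIV. f j * of_bool (j = i)) = f i"
  by (simp_all add: of_bool_def if_distrib cong: if_cong)

lemma std_gaussian_quadratic_form:
  "has_bochner_integral std_gaussian (\<lambda>z::real^'n. z \<bullet> (N *v z)) (trace N)"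
proof -
  have "has_bochner_integral std_gaussian (\<lambda>z::real^'n. z \<bullet> (N *v z))
     (\<Sum>i\<in>UNIV. \<Sum>j\<in>UNIV. N $ i $ j * of_bool (i = j))"
    unfolding quadratic_form_eq_sum
    by (intro has_bochner_integral_sum has_bochner_integral_mult_right std_gaussian_moment2)
  then show ?thesis
    by (simp add: of_bool_sum_delta trace_def)
qed

lemma std_gaussian_inner:
  "has_bochner_integral std_gaussian (\<lambda>z::real^'n. z \<bullet> v) 0"
proof -
  have "has_bochner_integral std_gaussian (\<lambda>z::real^'n. z \<bullet> v) (\<Sum>i\<in>UNIV. v $ i * 0)"
    unfolding inner_vec_def inner_real_def mult.commute[of "_ $ _" "v $ _"]
    by (intro has_bochner_integral_sum has_bochner_integral_mult_right std_gaussian_moment1)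
  then show ?thesis by simp
qed

lemma std_gaussian_inner_square:
  "has_bochner_integral std_gaussian (\<lambda>z::real^'n. (z \<bullet> v)\<^sup>2) (v \<bullet> v)"
proof -
  have "has_bochner_integral std_gaussian (\<lambda>z::real^'n. \<Sum>i\<in>UNIV. \<Sum>j\<in>UNIV. v $ i * v $ j * (z $ i * z $ j))
     (\<Sum>i\<in>UNIV. \<Sum>j\<in>UNIV. v $ i * v $ j * of_bool (i = j))"
    by (intro has_bochner_integral_sum has_bochner_integral_mult_right std_gaussian_moment2)
  moreover have "(z \<bullet> v)\<^sup>2 = (\<Sum>i\<in>UNIV. \<Sum>j\<in>UNIV. v $ i * v $ j * (z $ i * z $ j))" for z
    by (simp add: inner_vec_def power2_eq_square sum_product mult_ac)
  ultimately show ?thesis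
    by (simp add: of_bool_sum_delta inner_vec_def)
qed

lemma std_gaussian_quadratic_form_inner:
  "has_bochner_integral std_gaussian (\<lambda>z::real^'n. (z \<bullet> (N *v z)) * (z \<bullet> v)) 0"
proof -
  have "has_bochner_integral std_gaussian
      (\<lambda>z::real^'n. \<Sum>i\<in>UNIV. \<Sum>j\<in>UNIV. \<Sum>k\<in>UNIV. N $ i $ j * v $ k * (z $ i * z $ j * z $ k))
      (\<Sum>i\<in>(UNIV::'n set). \<Sum>j\<in>(UNIV::'n set). \<Sum>k\<in>(UNIV::'n set). N $ i $ j * v $ k * 0)"
    by (intro has_bochner_integral_sum has_bochner_integral_mult_right std_gaussian_moment3)
  moreover have "(z \<bullet> (N *v z)) * (z \<bullet> v) =
      (\<Sum>i\<in>UNIV. \<Sum>j\<in>UNIV. \<Sum>k\<in>UNIV. N $ i $ j * v $ k * (z $ i * z $ j * z $ k))" for z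
    unfolding quadratic_form_eq_sum
    by (simp add: inner_vec_def sum_distrib_left sum_distrib_right mult_ac)
  ultimately show ?thesis by simp
qed

text \<open>Summing over the pairings, \<open>i = j, k = l\<close> yields the squared trace and each
  of the other two yields \<open>trace (N ** N)\<close>; symmetry of \<open>N\<close> enters for
  \<open>i = k, j = l\<close>.\<close>

lemma std_gaussian_quadratic_form_square:
  assumes "transpose N = N"
  shows "has_bochner_integral std_gaussian (\<lambda>z::real^'n. (z \<bullet> (N *v z))\<^sup>2)
    ((trace N)\<^sup>2 + 2 * trace (N ** N))"
proof -
  have N: "N $ i $ j = N $ j $ i" for i j
    using arg_cong[OF assms, of "\<lambda>M. M $ i $ j"] by (simp add: transpose_def)
  let ?v = "\<lambda>i j k l. of_bool (i = j) * of_bool (k = l) + of_bool (i = k) * of_bool (j = l)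
      + of_bool (j = k) * of_bool (i = l) :: real"
  have "has_bochner_integral std_gaussian (\<lambda>z::real^'n.
      \<Sum>i\<in>UNIV. \<Sum>j\<in>UNIV. \<Sum>k\<in>UNIV. \<Sum>l\<in>UNIV. N $ i $ j * N $ k $ l * ((z $ i * z $ j) * (z $ k * z $ l)))
      (\<Sum>i\<in>UNIV. \<Sum>j\<in>UNIV. \<Sum>k\<in>UNIV. \<Sum>l\<in>UNIV. N $ i $ j * N $ k $ l * ?v i j k l)"
    by (intro has_bochner_integral_sum has_bochner_integral_mult_right std_gaussian_moment4)
  moreover have "(z \<bullet> (N *v z))\<^sup>2 = (\<Sum>i\<in>UNIV. \<Sum>j\<in>UNIV. \<Sum>k\<in>UNIV. \<Sum>l\<in>UNIV.
      N $ i $ j * N $ k $ l * ((z $ i * z $ j) * (z $ k * z $ l)))" for z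
    unfolding quadratic_form_eq_sum power2_eq_square sum_distrib_right
    unfolding sum_distrib_left by (intro sum.cong refl) (simp only: mult_ac)
  moreover have "(\<Sum>i\<in>UNIV. \<Sum>j\<in>UNIV. \<Sum>k\<in>UNIV. \<Sum>l\<in>UNIV. N $ i $ j * N $ k $ l * ?v i j k l) =
      (trace N)\<^sup>2 + 2 * trace (N ** N)"
  proof -
    have 1: "(\<Sum>i\<in>UNIV. \<Sum>j\<in>UNIV. \<Sum>k\<in>UNIV. \<Sum>l\<in>UNIV. N $ i $ j * N $ k $ l * (of_bool (i = j) * of_bool (k = l)))
        = (trace N)\<^sup>2"
      unfolding mult.assoc[symmetric] of_bool_sum_delta
      unfolding power2_eq_square trace_def sum_product
      by (simp add: sum_distrib_right[symmetric] of_bool_sum_delta)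
    have 2: "(\<Sum>i\<in>UNIV. \<Sum>j\<in>UNIV. \<Sum>k\<in>UNIV. \<Sum>l\<in>UNIV. N $ i $ j * N $ k $ l * (of_bool (i = k) * of_bool (j = l)))
        = trace (N ** N)"
      unfolding mult.assoc[symmetric] of_bool_sum_delta
      by (simp add: trace_def matrix_matrix_mult_def N)
    have 3: "(\<Sum>i\<in>UNIV. \<Sum>j\<in>UNIV. \<Sum>k\<in>UNIV. \<Sum>l\<in>UNIV. N $ i $ j * N $ k $ l * (of_bool (j = k) * of_bool (i = l)))
        = trace (N ** N)"
      unfolding mult.assoc[symmetric] of_bool_sum_delta
      by (simp add: trace_def matrix_matrix_mult_def of_bool_sum_delta)
    show ?thesis
      unfolding distrib_left sum.distrib 1 2 3 by simp
  qed
  ultimately show ?thesis by simp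
qed

text \<open>The difference has covariance \<open>2 I\<close>, so the form has mean
  \<open>2 * trace N\<close> and variance \<open>8 * trace (N ** N)\<close>, which explains the
  constants. The proof does not use the law of the difference: it expands the square and integrates
  over \<open>z'\<close>, then over \<open>z\<close>.\<close>

lemma std_gaussian_expected_square_difference:
  fixes N :: "real^'n^'n"
  assumes N: "transpose N = N"
  shows "(\<integral>\<^sup>+z. \<integral>\<^sup>+z'. ennreal (((z - z') \<bullet> (N *v (z - z')))\<^sup>2) \<partial>std_gaussian \<partial>std_gaussian)
    = ennreal (4 * (trace N)\<^sup>2 + 8 * trace (N ** N))"
proof -
  interpret prob_space "std_gaussian :: (real^'n) measure" by (rule prob_space_std_gaussian)
  let ?Q = "\<lambda>z. z \<bullet> (N *v z)"
  let ?t = "trace N" and ?s = "(trace N)\<^sup>2 + 2 * trace (N ** N)"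
  have const: "has_bochner_integral std_gaussian (\<lambda>z::real^'n. c) (c::real)" for c
    using prob_space by (simp add: has_bochner_integral_iff)
  have sym: "x \<bullet> (N *v y) = y \<bullet> (N *v x)" for x y
    by (metis N dot_lmul_matrix inner_commute transpose_matrix_vector)
  have inner: "(\<integral>\<^sup>+z'. ennreal ((?Q (z - z'))\<^sup>2) \<partial>std_gaussian)
      = ennreal ((?Q z)\<^sup>2 + ?s + 2 * ?t * ?Q z + 4 * (z \<bullet> ((N ** N) *v z)))" for z
  proof -
    \<comment> \<open>With \<open>b = z' \<bullet> (N *v z)\<close> this is the square of
      \<open>?Q z + ?Q z' - 2 * b\<close>. The last two summands are odd in \<open>z'\<close> and
      integrate to zero.\<close>
    have expand: "(?Q (z - z'))\<^sup>2 = (?Q z)\<^sup>2 + (?Q z')\<^sup>2 + 2 * ?Q z * ?Q z' + 4 * (z' \<bullet> (N *v z))\<^sup>2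
        + (- 4 * ?Q z) * (z' \<bullet> (N *v z)) + (- 4) * (?Q z' * (z' \<bullet> (N *v z)))" for z'
      by (simp add: matrix_vector_mult_diff_distrib inner_diff_left inner_diff_right sym[of z z'])
        (simp add: algebra_simps power2_eq_square)
    have "has_bochner_integral std_gaussian (\<lambda>z'. (?Q (z - z'))\<^sup>2)
        ((?Q z)\<^sup>2 + ?s + 2 * ?Q z * ?t + 4 * ((N *v z) \<bullet> (N *v z)) + (- 4 * ?Q z) * 0 + (- 4) * 0)"
      unfolding expand
      by (intro has_bochner_integral_add has_bochner_integral_mult_right const
        std_gaussian_quadratic_form_square std_gaussian_quadratic_form std_gaussian_inner_square
        std_gaussian_inner std_gaussian_quadratic_form_inner N)
    moreover have "(N *v z) \<bullet> (N *v z) = z \<bullet> ((N ** N) *v z)"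
      by (metis sym inner_commute matrix_vector_mul_assoc)
    ultimately have hb: "has_bochner_integral std_gaussian (\<lambda>z'. (?Q (z - z'))\<^sup>2)
        ((?Q z)\<^sup>2 + ?s + 2 * ?t * ?Q z + 4 * (z \<bullet> ((N ** N) *v z)))"
      by (simp add: mult_ac)
    show ?thesis
      by (subst nn_integral_eq_integral) (use hb in \<open>auto simp: has_bochner_integral_iff\<close>)
  qed
  have hb: "has_bochner_integral std_gaussian
      (\<lambda>z. (?Q z)\<^sup>2 + ?s + 2 * ?t * ?Q z + 4 * (z \<bullet> ((N ** N) *v z)))
      (?s + ?s + 2 * ?t * ?t + 4 * trace (N ** N))"
    by (intro has_bochner_integral_add has_bochner_integral_mult_right const
      std_gaussian_quadratic_form_square std_gaussian_quadratic_form N)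
  \<comment> \<open>Passing from the nonnegative integral to the Bochner integral requires a
    nonnegative integrand; completing the square shows this.\<close>
  have "0 \<le> (?Q z)\<^sup>2 + ?s + 2 * ?t * ?Q z + 4 * (z \<bullet> ((N ** N) *v z))" for z
  proof -
    have "0 \<le> trace (N ** N)"
    proof -
      have "trace (N ** N) = (\<Sum>i\<in>UNIV. \<Sum>k\<in>UNIV. (N $ i $ k)\<^sup>2)"
        unfolding trace_def matrix_matrix_mult_def power2_eq_square
        by (simp add: N[unfolded transpose_def vec_eq_iff, simplified])
      then show ?thesis by (simp add: sum_nonneg)
    qed
    moreover have "z \<bullet> ((N ** N) *v z) = (N *v z) \<bullet> (N *v z)"
      by (metis sym inner_commute matrix_vector_mul_assoc)
    then have "(?Q z)\<^sup>2 + ?s + 2 * ?t * ?Q z + 4 * (z \<bullet> ((N ** N) *v z)) =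
        (?Q z + ?t)\<^sup>2 + 2 * trace (N ** N) + 4 * ((N *v z) \<bullet> (N *v z))"
      by (simp add: power2_sum)
    ultimately show ?thesis by (simp only:) simp
  qed
  then have "(\<integral>\<^sup>+z. ennreal ((?Q z)\<^sup>2 + ?s + 2 * ?t * ?Q z + 4 * (z \<bullet> ((N ** N) *v z))) \<partial>std_gaussian)
      = ennreal (?s + ?s + 2 * ?t * ?t + 4 * trace (N ** N))"
    by (subst nn_integral_eq_integral) (use hb in \<open>auto simp: has_bochner_integral_iff\<close>)
  then show ?thesis
    unfolding inner by (simp add: power2_eq_square algebra_simps)
qed

section \<open>Rearrangement under doubly substochastic weights\<close>

text \<open>Ranks count from the largest index, which carries the largest eigenvalue in an ordered
  diagonalization, so that the eigenvalues of matrices of different sizes are matched from the top.\<close>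

definition top_rank :: "'a::{finite,linorder} \<Rightarrow> nat" where
  "top_rank i = card {k. i < k}"

lemma top_rank_strict_antimono:
  fixes i j :: "'a::{finite,linorder}"
  assumes "i < j" shows "top_rank j < top_rank i"
  unfolding top_rank_def using assms by (intro psubset_card_mono) auto

lemma top_rank_le_iff: "top_rank i \<le> top_rank j \<longleftrightarrow> j \<le> i"
  by (metis linorder_not_le order_le_less top_rank_strict_antimono)

lemma top_rank_eq_iff [simp]: "top_rank i = top_rank j \<longleftrightarrow> i = j"
  by (metis linorder_neq_iff less_irrefl top_rank_strict_antimono)

lemma range_top_rank: "range (top_rank :: 'a::{finite,linorder} \<Rightarrow> nat) = {..<CARD('a)}"
proof (rule card_subset_eq)
  show "range (top_rank :: 'a \<Rightarrow> nat) \<subseteq> {..<CARD('a)}"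
    unfolding top_rank_def by (auto intro!: psubset_card_mono)
  show "card (range (top_rank :: 'a \<Rightarrow> nat)) = card {..<CARD('a)}"
    by (simp add: card_image inj_on_def)
qed simp

lemma top_rank_less_card: "top_rank (i::'a::{finite,linorder}) < CARD('a)"
  using range_top_rank[where 'a = 'a] by blast

lemma ex_top_rank: "r < CARD('a::{finite,linorder}) \<Longrightarrow> \<exists>i::'a. top_rank i = r"
  using range_top_rank[where 'a = 'a] by (metis imageE lessThan_iff)

text \<open>Padding by zero beyond the last rank puts eigenvalue lists of different lengths on the
  common index set of natural numbers.\<close>

definition rank_seq :: "('a::{finite,linorder} \<Rightarrow> real) \<Rightarrow> nat \<Rightarrow> real" where
  "rank_seq a r = (\<Sum>i\<in>UNIV. if top_rank i = r then a i else 0)"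

lemma rank_seq_top_rank [simp]: "rank_seq a (top_rank i) = a i"
  by (simp add: rank_seq_def)

lemma rank_seq_beyond: "CARD('a) \<le> r \<Longrightarrow> rank_seq (a :: 'a::{finite,linorder} \<Rightarrow> real) r = 0"
  using top_rank_less_card[where 'a = 'a] by (auto simp: rank_seq_def intro!: sum.neutral) (metis leD)

lemma rank_seq_nonneg: "(\<And>i. 0 \<le> a i) \<Longrightarrow> 0 \<le> rank_seq a r"
  by (simp add: rank_seq_def sum_nonneg)

text \<open>Nonnegativity keeps the sequence decreasing where the zero padding starts.\<close>

lemma antimono_rank_seq:
  fixes a :: "'a::{finite,linorder} \<Rightarrow> real"
  assumes "mono a" "\<And>i. 0 \<le> a i"
  shows "antimono (rank_seq a)"
proof (rule antimonoI)
  fix r s :: nat assume "r \<le> s"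
  show "rank_seq a s \<le> rank_seq a r"
  proof (cases "s < CARD('a)")
    case True
    then obtain i j :: 'a where ij: "r = top_rank i" "s = top_rank j"
      using \<open>r \<le> s\<close> ex_top_rank[where 'a = 'a] by (metis le_less_trans)
    then have "j \<le> i" using \<open>r \<le> s\<close> by (simp add: top_rank_le_iff)
    then show ?thesis using ij \<open>mono a\<close> by (simp add: monoD)
  qed (use assms in \<open>simp add: rank_seq_beyond rank_seq_nonneg\<close>)
qed

section \<open>Duality for the assignment problem\<close>

text \<open>The middle term is a discrete Stieltjes sum of \<open>\<beta>\<close> against the
  decrements of \<open>\<alpha>\<close>. Replacing \<open>\<beta>\<close> by its smallest or largest
  value on the range leaves a telescoping sum.\<close>

lemma sum_decrement_bounds:
  fixes \<alpha> \<beta> :: "nat \<Rightarrow> real"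
  assumes "antimono \<alpha>" "antimono \<beta>" "m \<le> n"
  shows "\<beta> n * (\<alpha> m - \<alpha> n) \<le> (\<Sum>k=m..<n. (\<alpha> k - \<alpha> (Suc k)) * \<beta> k)" (is ?lower)
    and "(\<Sum>k=m..<n. (\<alpha> k - \<alpha> (Suc k)) * \<beta> k) \<le> \<beta> m * (\<alpha> m - \<alpha> n)" (is ?upper)
proof -
  have tele: "(\<Sum>k=m..<n. (\<alpha> k - \<alpha> (Suc k)) * c) = c * (\<alpha> m - \<alpha> n)" for c
    using sum_Suc_diff'[of m n "\<lambda>k. - \<alpha> k"] \<open>m \<le> n\<close>
    unfolding sum_distrib_right[symmetric] by simp
  have dec: "0 \<le> \<alpha> k - \<alpha> (Suc k)" for k
    using assms(1) by (simp add: antimonoD)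
  show ?lower
    unfolding tele[symmetric] using assms dec by (intro sum_mono mult_left_mono) (auto simp: antimonoD)
  show ?upper
    unfolding tele[symmetric] using assms dec by (intro sum_mono mult_left_mono) (auto simp: antimonoD)
qed

text \<open>Linear programming duality: \<open>u\<close> and \<open>v\<close> in the proof are dual potentials of the assignment problem,
  tight on the comonotone assignment.\<close>

lemma substochastic_rearrangement:
  fixes a :: "'p::{finite,linorder} \<Rightarrow> real" and b :: "'q::{finite,linorder} \<Rightarrow> real"
  assumes a: "mono a" "\<And>i. 0 \<le> a i" and b: "mono b" "\<And>j. 0 \<le> b j"
    and w: "\<And>j i. 0 \<le> w j i" "\<And>j. (\<Sum>i\<in>UNIV. w j i) \<le> 1" "\<And>i. (\<Sum>j\<in>UNIV. w j i) \<le> 1"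
  shows "(\<Sum>j\<in>UNIV. \<Sum>i\<in>UNIV. w j i * (a i * b j))
    \<le> (\<Sum>j\<in>UNIV. \<Sum>i\<in>UNIV. of_bool (top_rank j = top_rank i) * (a i * b j))"
proof -
  define N where "N = max CARD('p) CARD('q)"
  define \<alpha> where "\<alpha> = rank_seq a"
  define \<beta> where "\<beta> = rank_seq b"
  define u where "u r = (\<Sum>k=r..<N. (\<alpha> k - \<alpha> (Suc k)) * \<beta> k)" for r
  define v where "v r = \<alpha> r * \<beta> r - u r" for r
  have anti: "antimono \<alpha>" "antimono \<beta>"
    unfolding \<alpha>_def \<beta>_def using a b by (auto intro: antimono_rank_seq)
  have nonneg: "0 \<le> \<alpha> r" "0 \<le> \<beta> r" for r
    unfolding \<alpha>_def \<beta>_def using a b by (auto intro: rank_seq_nonneg)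
  have p: "top_rank i < N" for i :: 'p
    using top_rank_less_card[of i] by (simp add: N_def)
  have q: "top_rank j < N" for j :: 'q
    using top_rank_less_card[of j] by (simp add: N_def)
  have u0: "0 \<le> u r" for r
    unfolding u_def using anti nonneg by (intro sum_nonneg mult_nonneg_nonneg) (auto simp: antimonoD)
  have v0: "0 \<le> v r" if "r < N" for r
  proof -
    have "u r \<le> \<beta> r * (\<alpha> r - \<alpha> N)"
      unfolding u_def using that by (intro sum_decrement_bounds anti) simp
    moreover have "0 \<le> \<beta> r * \<alpha> N" using nonneg by simp
    ultimately show ?thesis by (simp add: v_def algebra_simps)
  qed
  \<comment> \<open>Dual feasibility. In either order of \<open>r\<close> and \<open>s\<close> the
    Stieltjes bounds give \<open>u r - u s \<ge> \<beta> s * (\<alpha> r - \<alpha> s)\<close>, and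
    \<open>v s = \<alpha> s * \<beta> s - u s\<close>.\<close>
  have feasible: "\<alpha> r * \<beta> s \<le> u r + v s" if "r < N" "s < N" for r s
  proof (cases "r \<le> s")
    case True
    have "u r = (\<Sum>k=r..<s. (\<alpha> k - \<alpha> (Suc k)) * \<beta> k) + u s"
      unfolding u_def using that True by (simp add: sum.atLeastLessThan_concat)
    moreover have "\<beta> s * (\<alpha> r - \<alpha> s) \<le> (\<Sum>k=r..<s. (\<alpha> k - \<alpha> (Suc k)) * \<beta> k)"
      using True by (intro sum_decrement_bounds anti)
    ultimately show ?thesis by (simp add: v_def algebra_simps)
  next
    case False
    then have "u s = (\<Sum>k=s..<r. (\<alpha> k - \<alpha> (Suc k)) * \<beta> k) + u r"
      unfolding u_def using that by (simp add: sum.atLeastLessThan_concat)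
    moreover have "(\<Sum>k=s..<r. (\<alpha> k - \<alpha> (Suc k)) * \<beta> k) \<le> \<beta> s * (\<alpha> s - \<alpha> r)"
      using False by (intro sum_decrement_bounds anti) simp
    ultimately show ?thesis by (simp add: v_def algebra_simps)
  qed
  have "(\<Sum>j\<in>UNIV. \<Sum>i\<in>UNIV. w j i * (a i * b j))
      \<le> (\<Sum>j\<in>UNIV. \<Sum>i\<in>UNIV. w j i * (u (top_rank i) + v (top_rank j)))"
    using feasible[OF p q] w(1) by (intro sum_mono mult_left_mono) (auto simp: \<alpha>_def \<beta>_def)
  also have "\<dots> = (\<Sum>i\<in>UNIV. (\<Sum>j\<in>UNIV. w j i) * u (top_rank i))
      + (\<Sum>j\<in>UNIV. (\<Sum>i\<in>UNIV. w j i) * v (top_rank j))"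
    by (simp add: distrib_left sum.distrib sum_distrib_right sum.swap[of _ "UNIV :: 'q set"])
  \<comment> \<open>Row and column sums may fall short of 1; the sign of the potentials makes this
    harmless. The same sign later allows both sums to be extended to all ranks below
    \<open>N\<close>.\<close>
  also have "\<dots> \<le> (\<Sum>i\<in>(UNIV::'p set). u (top_rank i)) + (\<Sum>j\<in>(UNIV::'q set). v (top_rank j))"
    using w u0 v0[OF q] by (intro add_mono sum_mono mult_left_le_one_le) (auto intro: sum_nonneg)
  also have "\<dots> = sum u (range (top_rank :: 'p \<Rightarrow> nat)) + sum v (range (top_rank :: 'q \<Rightarrow> nat))"
    by (simp add: sum.reindex inj_on_def)
  also have "\<dots> \<le> sum u {..<N} + sum v {..<N}"
    using p q u0 v0 by (intro add_mono sum_mono2) auto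
  also have "\<dots> = (\<Sum>r<N. \<alpha> r * \<beta> r)"
    by (simp add: v_def sum.distrib[symmetric])
  also have "\<dots> = (\<Sum>r<N. \<Sum>j\<in>UNIV. \<Sum>i\<in>UNIV. of_bool (top_rank j = r) * of_bool (top_rank i = r) * (a i * b j))"
    unfolding \<alpha>_def \<beta>_def rank_seq_def sum_product
    by (intro sum.cong refl, subst sum.swap) (auto intro!: sum.cong)
  also have "\<dots> = (\<Sum>j\<in>UNIV. \<Sum>i\<in>UNIV. \<Sum>r<N. of_bool (top_rank j = r) * of_bool (top_rank i = r) * (a i * b j))"
    by (subst sum.swap, intro sum.cong refl, rule sum.swap)
  also have "\<dots> = (\<Sum>j\<in>UNIV. \<Sum>i\<in>UNIV. of_bool (top_rank j = top_rank i) * (a i * b j))"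
  proof (intro sum.cong refl)
    fix j :: 'q and i :: 'p
    have "(\<Sum>r<N. of_bool (top_rank j = r) * of_bool (top_rank i = r) * (a i * b j))
        = (\<Sum>r<N. if r = top_rank j then of_bool (top_rank i = r) * (a i * b j) else 0)"
      by (intro sum.cong) auto
    then show "(\<Sum>r<N. of_bool (top_rank j = r) * of_bool (top_rank i = r) * (a i * b j))
        = of_bool (top_rank j = top_rank i) * (a i * b j)"
      using q[of j] by (auto simp: sum.delta)
  qed
  finally show ?thesis .
qed

section \<open>Traces as assignment values\<close>

lemma diagonal_matrix_mult_right: "diagonal_matrix D \<Longrightarrow> (A ** D) $ i $ j = A $ i $ j * D $ j $ j"
  unfolding matrix_matrix_mult_def diagonal_matrix_def
  by (simp, subst sum.remove[of _ j]) (auto intro!: sum.neutral)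

lemma diagonal_matrix_mult_left: "diagonal_matrix D \<Longrightarrow> (D ** A) $ i $ j = D $ i $ i * A $ i $ j"
  unfolding matrix_matrix_mult_def diagonal_matrix_def
  by (simp, subst sum.remove[of _ i]) (auto intro!: sum.neutral)

lemma transpose_nth [simp]: "transpose A $ i $ j = A $ j $ i"
  by (simp add: transpose_def)

text \<open>The objective is linear in the squared entries of \<open>B\<close>, so it can be
  optimised over weights instead of matrices.\<close>

lemma trace_diagonal_quadratic:
  assumes "diagonal_matrix D" "diagonal_matrix E"
  shows "trace (D ** transpose B ** E ** B) = (\<Sum>j\<in>UNIV. \<Sum>i\<in>UNIV. (B $ j $ i)\<^sup>2 * (D $ i $ i * E $ j $ j))"
proof -
  have "trace (D ** transpose B ** E ** B) = (\<Sum>i\<in>UNIV. \<Sum>j\<in>UNIV. (D ** transpose B ** E) $ i $ j * B $ j $ i)"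
    by (simp add: trace_def matrix_matrix_mult_def)
  also have "\<dots> = (\<Sum>i\<in>UNIV. \<Sum>j\<in>UNIV. (B $ j $ i)\<^sup>2 * (D $ i $ i * E $ j $ j))"
    using assms
    by (simp add: diagonal_matrix_mult_left diagonal_matrix_mult_right power2_eq_square mult_ac)
  finally show ?thesis by (subst sum.swap)
qed

lemma orthogonal_rows_column_bound:
  fixes B :: "'q::finite \<Rightarrow> 'p::finite \<Rightarrow> real"
  assumes orth: "\<And>j k. j \<noteq> k \<Longrightarrow> (\<Sum>i\<in>UNIV. B j i * B k i) = 0"
    and le1: "\<And>j. (\<Sum>i\<in>UNIV. (B j i)\<^sup>2) \<le> 1"
  shows "(\<Sum>j\<in>UNIV. (B j i)\<^sup>2) \<le> 1"
proof -
  define s where "s = (\<Sum>j\<in>UNIV. (B j i)\<^sup>2)"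
  \<comment> \<open>The vector \<open>y\<close> is \<open>B^T B\<close> applied to the
    \<open>i\<close>-th coordinate vector. Its squared norm is at most \<open>s\<close> and its
    \<open>i\<close>-th entry is \<open>s\<close>, whence \<open>s * s \<le> s\<close>.\<close>
  define y where "y l = (\<Sum>j\<in>UNIV. B j i * B j l)" for l
  have "(\<Sum>l\<in>UNIV. (y l)\<^sup>2) = (\<Sum>j\<in>UNIV. \<Sum>k\<in>UNIV. B j i * B k i * (\<Sum>l\<in>UNIV. B j l * B k l))"
  proof -
    have "(\<Sum>l\<in>UNIV. (y l)\<^sup>2) = (\<Sum>l\<in>UNIV. \<Sum>j\<in>UNIV. \<Sum>k\<in>UNIV. B j i * B k i * (B j l * B k l))"
      unfolding y_def power2_eq_square sum_product by (simp only: mult_ac)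
    also have "\<dots> = (\<Sum>j\<in>UNIV. \<Sum>l\<in>UNIV. \<Sum>k\<in>UNIV. B j i * B k i * (B j l * B k l))"
      by (rule sum.swap)
    also have "\<dots> = (\<Sum>j\<in>UNIV. \<Sum>k\<in>UNIV. \<Sum>l\<in>UNIV. B j i * B k i * (B j l * B k l))"
      by (rule sum.cong[OF refl sum.swap])
    finally show ?thesis by (simp only: sum_distrib_left)
  qed
  also have "\<dots> = (\<Sum>j\<in>UNIV. (B j i)\<^sup>2 * (\<Sum>l\<in>UNIV. (B j l)\<^sup>2))"
  proof (intro sum.cong refl)
    fix j
    have "(\<Sum>k\<in>UNIV. B j i * B k i * (\<Sum>l\<in>UNIV. B j l * B k l))
        = (\<Sum>k\<in>UNIV. if k = j then (B j i)\<^sup>2 * (\<Sum>l\<in>UNIV. (B j l)\<^sup>2) else 0)"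
      by (intro sum.cong) (auto simp: orth power2_eq_square)
    then show "(\<Sum>k\<in>UNIV. B j i * B k i * (\<Sum>l\<in>UNIV. B j l * B k l)) = (B j i)\<^sup>2 * (\<Sum>l\<in>UNIV. (B j l)\<^sup>2)"
      by simp
  qed
  also have "\<dots> \<le> s"
    unfolding s_def using le1 by (intro sum_mono mult_right_le_one_le) (auto intro: sum_nonneg)
  finally have "(\<Sum>l\<in>UNIV. (y l)\<^sup>2) \<le> s" .
  moreover have "(y i)\<^sup>2 \<le> (\<Sum>l\<in>UNIV. (y l)\<^sup>2)"
    by (rule member_le_sum) auto
  moreover have "y i = s" by (simp add: y_def s_def power2_eq_square)
  ultimately have "s * s \<le> s * 1" by (simp add: power2_eq_square)
  moreover have "0 \<le> s" by (simp add: s_def sum_nonneg)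
  ultimately show ?thesis unfolding s_def[symmetric]
    by (metis mult_le_cancel_left_pos order_le_less zero_le_one)
qed

section \<open>Square roots and diagonalized matrices\<close>

definition map_diag :: "(real \<Rightarrow> real) \<Rightarrow> real^'n^'n \<Rightarrow> real^'n^'n" where
  "map_diag f D = (\<chi> i j. if i = j then f (D $ i $ i) else 0)"

lemma map_diag_nth: "map_diag f D $ i $ j = (if i = j then f (D $ i $ i) else 0)"
  by (simp add: map_diag_def)

lemma diagonal_map_diag [simp]: "diagonal_matrix (map_diag f D)"
  by (simp add: map_diag_nth diagonal_matrix_def)

lemma map_diag_sqrt_square:
  assumes "diagonal_matrix D" "\<And>i. 0 \<le> D $ i $ i"
  shows "map_diag sqrt D ** map_diag sqrt D = D"
  using assms
  by (auto simp: vec_eq_iff diagonal_matrix_mult_right map_diag_nth diagonal_matrix_def)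

lemma matrix_mult_nth: "(A ** B) $ i $ j = (\<Sum>k\<in>UNIV. A $ i $ k * B $ k $ j)"
  by (simp add: matrix_matrix_mult_def)

lemma inner_matrix_vector_transpose: "x \<bullet> (A *v y) = (transpose A *v x) \<bullet> (y :: real^'n)"
  by (simp add: dot_lmul_matrix)

lemma orthogonal_matrix_cancel:
  fixes V :: "real^'n^'n" and A :: "real^'m^'n" and B :: "real^'n^'k"
  assumes "orthogonal_matrix V"
  shows "transpose V ** (V ** A) = A" "V ** (transpose V ** A) = A"
    "B ** V ** transpose V = B" "B ** transpose V ** V = B"
  using assms by (simp_all add: orthogonal_matrix_def matrix_mul_assoc, simp_all add: matrix_mul_assoc[symmetric])

lemma inner_diagonal_matrix:
  assumes "diagonal_matrix D"
  shows "y \<bullet> (D *v y) = (\<Sum>i\<in>UNIV. D $ i $ i * (y $ i)\<^sup>2)"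
proof -
  have "(D *v y) $ i = D $ i $ i * y $ i" for i
    unfolding matrix_vector_mult_def using assms
    by (simp add: diagonal_matrix_def, subst sum.remove[of _ i]) (auto intro!: sum.neutral)
  then show ?thesis by (simp add: inner_vec_def power2_eq_square mult_ac)
qed

lemma psd_orthogonal_conjugate:
  assumes "diagonal_matrix D" "\<And>i. 0 \<le> D $ i $ i"
  shows "psd_matrix (V ** D ** transpose V)"
  unfolding psd_matrix_def
proof (intro conjI allI)
  have "transpose D = D"
    using assms(1) by (auto simp: vec_eq_iff diagonal_matrix_def) metis
  then show "transpose (V ** D ** transpose V) = V ** D ** transpose V"
    by (simp add: matrix_transpose_mul matrix_mul_assoc)
  fix x
  have "x \<bullet> (V ** D ** transpose V *v x) = (transpose V *v x) \<bullet> (D *v (transpose V *v x))"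
    by (simp add: inner_matrix_vector_transpose[of x] matrix_vector_mul_assoc[symmetric])
  then show "0 \<le> x \<bullet> (V ** D ** transpose V *v x)"
    using assms by (simp add: inner_diagonal_matrix sum_nonneg)
qed

text \<open>The defect \<open>w = R v - sqrt d v\<close> satisfies \<open>R w = - sqrt d w\<close>, which positivity of \<open>R\<close> excludes
  for \<open>d > 0\<close> unless \<open>w = 0\<close>.\<close>

lemma psd_square_root_eigenvector:
  assumes R: "psd_matrix R" and d: "0 \<le> d" and v: "R *v (R *v v) = d *\<^sub>R v"
  shows "R *v v = sqrt d *\<^sub>R v"
proof -
  define w where "w = R *v v - sqrt d *\<^sub>R v"
  have "R *v w = (- sqrt d) *\<^sub>R w"
    using d by (simp add: w_def matrix_vector_mult_diff_distrib matrix_vector_mult_scaleR v algebra_simps)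
  then have "w \<bullet> (R *v w) = - (sqrt d * (w \<bullet> w))" by simp
  moreover have "0 \<le> w \<bullet> (R *v w)" using R by (simp add: psd_matrix_def)
  ultimately have "sqrt d * (w \<bullet> w) \<le> 0" by simp
  then have "d = 0 \<or> w = 0"
    using d by (cases "w = 0") (auto simp: mult_le_0_iff not_le[symmetric] dest: inner_gt_zero_iff[THEN iffD2])
  \<comment> \<open>For \<open>d = 0\<close> positivity gives no information; symmetry does, since
    the squared norm of \<open>R *v v\<close> is \<open>v \<bullet> (R *v (R *v v))\<close>.\<close>
  moreover have "w = 0" if "d = 0"
  proof -
    have "(R *v v) \<bullet> (R *v v) = v \<bullet> (R *v (R *v v))"
      using R by (simp add: psd_matrix_def inner_matrix_vector_transpose[of v])
    then show ?thesis using v that by (simp add: w_def)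
  qed
  ultimately show ?thesis by (auto simp: w_def)
qed

text \<open>As \<open>matrix_sqrt\<close> is a definite description, uniqueness is part of the
  claim: every positive semidefinite root acts on each column of \<open>V\<close> as the root of its
  eigenvalue, and these columns form a basis.\<close>

lemma matrix_sqrt_diagonalization:
  assumes V: "orthogonal_matrix V" and D: "diagonal_matrix D" "\<And>i. 0 \<le> D $ i $ i"
  shows "matrix_sqrt (V ** D ** transpose V) = V ** map_diag sqrt D ** transpose V"
  unfolding matrix_sqrt_def
proof (rule the_equality)
  have "V ** map_diag sqrt D ** transpose V ** (V ** map_diag sqrt D ** transpose V)
      = V ** (map_diag sqrt D ** map_diag sqrt D) ** transpose V"
    by (simp add: matrix_mul_assoc orthogonal_matrix_cancel[OF V])
  moreover have "psd_matrix (V ** map_diag sqrt D ** transpose V)"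
    using D by (intro psd_orthogonal_conjugate) (simp_all add: map_diag_nth)
  ultimately show "psd_matrix (V ** map_diag sqrt D ** transpose V) \<and>
      V ** map_diag sqrt D ** transpose V ** (V ** map_diag sqrt D ** transpose V) = V ** D ** transpose V"
    using D by (simp add: map_diag_sqrt_square)
next
  fix R assume R: "psd_matrix R \<and> R ** R = V ** D ** transpose V"
  have col: "column i (A ** B) = A *v column i B" for A B :: "real^'a^'a" and i
    by (simp add: vec_eq_iff column_def matrix_matrix_mult_def matrix_vector_mult_def)
  have scale: "column i (V ** map_diag f D) = f (D $ i $ i) *\<^sub>R column i V" for f i
    by (simp add: vec_eq_iff column_def diagonal_matrix_mult_right map_diag_nth)
  have "column i (R ** V) = column i (V ** map_diag sqrt D)" for i
  proof -
    have "D = map_diag (\<lambda>x. x) D"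
      using D(1) by (auto simp: vec_eq_iff map_diag_nth diagonal_matrix_def)
    moreover have "R ** R ** V = V ** D"
      using R by (simp add: orthogonal_matrix_cancel[OF V])
    ultimately have "column i (R ** R ** V) = (D $ i $ i) *\<^sub>R column i V"
      using scale[of i "\<lambda>x. x"] by simp
    then have "R *v (R *v column i V) = (D $ i $ i) *\<^sub>R column i V"
      by (simp add: col matrix_vector_mul_assoc)
    then show ?thesis
      unfolding scale unfolding col using R D(2) by (intro psd_square_root_eigenvector) auto
  qed
  then have "R ** V = V ** map_diag sqrt D"
    by (simp add: vec_eq_iff column_def)
  then show "R = V ** map_diag sqrt D ** transpose V"
    by (metis orthogonal_matrix_cancel(3)[OF V])
qed

text \<open>The eigenvalue is the quadratic form evaluated at the unit eigenvector
  \<open>V *v axis i 1\<close>.\<close>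

lemma psd_diagonalization_nonneg:
  assumes "psd_matrix (V ** D ** transpose V)" "orthogonal_matrix V" "diagonal_matrix D"
  shows "0 \<le> D $ i $ i"
proof -
  have "V ** D ** transpose V ** V = V ** D"
    by (rule orthogonal_matrix_cancel(4)[OF assms(2)])
  then have "(V ** D ** transpose V) *v (V *v axis i 1) = V *v (D *v axis i 1)"
    by (simp add: matrix_vector_mul_assoc)
  moreover have "transpose V *v (V *v axis i 1) = axis i 1"
    using assms(2) by (simp only: matrix_vector_mul_assoc orthogonal_matrix_def matrix_vector_mul_lid)
  moreover have "0 \<le> (V *v axis i 1) \<bullet> ((V ** D ** transpose V) *v (V *v axis i 1))"
    using assms(1) by (simp add: psd_matrix_def)
  ultimately have "0 \<le> axis i 1 \<bullet> (D *v axis i 1)"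
    by (simp only: inner_matrix_vector_transpose[of _ V])
  also have "\<dots> = (\<Sum>j\<in>UNIV. if j = i then D $ i $ i else 0)"
    unfolding inner_diagonal_matrix[OF assms(3)] by (intro sum.cong) (auto simp: axis_def)
  finally show ?thesis by simp
qed

section \<open>The matching of eigenvalues from the top\<close>

text \<open>The identity block is aligned at the largest indices, so that the largest eigenvalues of
  both matrices meet.\<close>

definition rect_id :: "real^('p::{finite,linorder})^('q::{finite,linorder})" where
  "rect_id = (\<chi> j i. of_bool (top_rank j = top_rank i))"

lemma rect_id_nth: "rect_id $ j $ i = of_bool (top_rank j = top_rank i)"
  by (simp add: rect_id_def)

lemma transpose_rect_id: "transpose rect_id = rect_id"
  by (simp add: vec_eq_iff rect_id_nth eq_commute)

lemma rect_id_square: "(rect_id :: real^('n::{finite,linorder})^('n::{finite,linorder})) = mat 1"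
  by (simp add: vec_eq_iff rect_id_nth mat_def)

lemma rect_id_stiefel:
  assumes "CARD('p) \<le> CARD('q)"
  shows "(rect_id :: real^('p::{finite,linorder})^('q::{finite,linorder})) \<in> stiefel"
proof -
  have "(\<Sum>j\<in>(UNIV::'q set). of_bool (top_rank j = top_rank i) * of_bool (top_rank j = top_rank k)) = (of_bool (i = k) :: real)"
    for i k :: 'p
  proof -
    obtain j0 :: 'q where j0: "top_rank j0 = top_rank i"
      using assms top_rank_less_card[of i] ex_top_rank[of "top_rank i", where 'a = 'q] by auto
    have "top_rank j = top_rank i \<longleftrightarrow> j = j0" "top_rank j0 = top_rank k \<longleftrightarrow> i = k" for j
      using j0 top_rank_eq_iff[of j j0] top_rank_eq_iff[of i k] by simp_all
    then have "of_bool (top_rank j = top_rank i) * of_bool (top_rank j = top_rank k)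
        = (if j = j0 then of_bool (i = k) else (0::real))" for j
      by (cases "j = j0") simp_all
    then show ?thesis by simp
  qed
  then show ?thesis
    by (simp add: stiefel_def vec_eq_iff matrix_matrix_mult_def rect_id_nth mat_def of_bool_def)
qed

text \<open>The common bound for both problems: \<open>w\<close> will be either the squared entries
  of a Stiefel matrix or the weights of a feasible map.\<close>

lemma rearrangement_trace_le:
  fixes D :: "real^('p::{finite,linorder})^('p::{finite,linorder})"
    and E :: "real^('q::{finite,linorder})^('q::{finite,linorder})"
  assumes D: "diagonal_matrix D" "\<And>i. 0 \<le> D $ i $ i" "\<And>i j. i \<le> j \<Longrightarrow> D $ i $ i \<le> D $ j $ j"
    and E: "diagonal_matrix E" "\<And>i. 0 \<le> E $ i $ i" "\<And>i j. i \<le> j \<Longrightarrow> E $ i $ i \<le> E $ j $ j"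
    and w: "\<And>j i. 0 \<le> w j i" "\<And>j. (\<Sum>i\<in>UNIV. w j i) \<le> 1" "\<And>i. (\<Sum>j\<in>UNIV. w j i) \<le> 1"
  shows "(\<Sum>j\<in>UNIV. \<Sum>i\<in>UNIV. w j i * (D $ i $ i * E $ j $ j)) \<le> trace (D ** transpose rect_id ** E ** rect_id)"
proof -
  have "(\<Sum>j\<in>UNIV. \<Sum>i\<in>UNIV. w j i * (D $ i $ i * E $ j $ j))
    \<le> (\<Sum>j\<in>UNIV. \<Sum>i\<in>UNIV. of_bool (top_rank j = top_rank i) * (D $ i $ i * E $ j $ j))"
    using assms by (intro substochastic_rearrangement) (auto intro: monoI)
  also have "\<dots> = trace (D ** transpose rect_id ** E ** rect_id)"
    using D E
    by (auto simp: trace_diagonal_quadratic[OF D(1) E(1)] rect_id_nth of_bool_def intro!: sum.cong)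
  finally show ?thesis .
qed

lemma orthonormal_rows_substochastic:
  fixes B :: "real^'p^'q"
  assumes "B ** transpose B = mat 1"
  shows "(\<Sum>i\<in>UNIV. (B $ j $ i)\<^sup>2) \<le> 1" "(\<Sum>j\<in>UNIV. (B $ j $ i)\<^sup>2) \<le> 1"
proof -
  have *: "(\<Sum>i\<in>UNIV. B $ j $ i * B $ k $ i) = of_bool (j = k)" for j k
    using arg_cong[OF assms, of "\<lambda>M. M $ j $ k"] by (simp add: matrix_matrix_mult_def mat_def)
  show row: "(\<Sum>i\<in>UNIV. (B $ j $ i)\<^sup>2) \<le> 1" for j
    using *[of j j] by (simp add: power2_eq_square)
  show "(\<Sum>j\<in>UNIV. (B $ j $ i)\<^sup>2) \<le> 1"
    by (rule orthogonal_rows_column_bound) (simp_all add: * row)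
qed

lemma stiefel_substochastic:
  fixes B :: "real^'p^'q"
  assumes "B \<in> stiefel \<or> transpose B \<in> stiefel"
  shows "(\<Sum>i\<in>UNIV. (B $ j $ i)\<^sup>2) \<le> 1" "(\<Sum>j\<in>UNIV. (B $ j $ i)\<^sup>2) \<le> 1"
  using assms orthonormal_rows_substochastic[of "transpose B"] orthonormal_rows_substochastic[of B]
  by (auto simp: stiefel_def)

text \<open>For \<open>G D G^T = E\<close> the weights \<open>W j i = G j i ^ 2 D i i / E j j\<close> (zero in the rows with \<open>E j j = 0\<close>)
  are doubly substochastic and turn the objective into an assignment cost.\<close>

lemma feasible_weights:
  fixes G :: "real^'p^'q"
  assumes D: "diagonal_matrix D" "\<And>i. 0 \<le> D $ i $ i"
    and E: "diagonal_matrix E" "\<And>j. 0 \<le> E $ j $ j"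
    and G: "G ** D ** transpose G = E"
  defines "W \<equiv> \<lambda>j i. (G $ j $ i)\<^sup>2 * D $ i $ i / E $ j $ j"
  shows "0 \<le> W j i" "(\<Sum>i\<in>UNIV. W j i) = of_bool (E $ j $ j \<noteq> 0)" "(\<Sum>j\<in>UNIV. W j i) \<le> 1"
    "(G $ j $ i)\<^sup>2 * D $ i $ i = W j i * E $ j $ j"
proof -
  \<comment> \<open>This is \<open>E^(-1/2) G D^(1/2)\<close>, with zero rows where \<open>E\<close>
    vanishes because division by zero yields 0. The weights are its squared entries.\<close>
  define B where "B j i = G $ j $ i * sqrt (D $ i $ i) / sqrt (E $ j $ j)" for j i
  have W: "W j i = (B j i)\<^sup>2" for j i
    using D E by (simp add: W_def B_def power_divide power_mult_distrib)
  show "0 \<le> W j i" by (simp add: W)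
  have entry: "(\<Sum>i\<in>UNIV. G $ j $ i * D $ i $ i * G $ k $ i) = E $ j $ k" for j k
    using arg_cong[OF G, of "\<lambda>M. M $ j $ k"] D(1)
    by (simp add: matrix_mult_nth[of "G ** D" "transpose G"] diagonal_matrix_mult_right)
  have diag: "(\<Sum>i\<in>UNIV. (G $ j $ i)\<^sup>2 * D $ i $ i) = E $ j $ j" for j
    using entry[of j j] by (simp add: power2_eq_square mult_ac)
  show row: "(\<Sum>i\<in>UNIV. W j i) = of_bool (E $ j $ j \<noteq> 0)" for j
    using diag[of j] by (simp add: W_def sum_divide_distrib[symmetric])
  have "(\<Sum>i\<in>UNIV. B j i * B k i) = 0" if "j \<noteq> k" for j k
  proof -
    have "B j i * B k i = G $ j $ i * D $ i $ i * G $ k $ i / (sqrt (E $ j $ j) * sqrt (E $ k $ k))" for i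
    proof -
      have "G $ j $ i * sqrt (D $ i $ i) * (G $ k $ i * sqrt (D $ i $ i))
          = G $ j $ i * (sqrt (D $ i $ i) * sqrt (D $ i $ i)) * G $ k $ i"
        by (simp only: mult_ac)
      then show ?thesis
        unfolding B_def times_divide_times_eq using D(2)[of i] by simp
    qed
    then have "(\<Sum>i\<in>UNIV. B j i * B k i)
        = (\<Sum>i\<in>UNIV. G $ j $ i * D $ i $ i * G $ k $ i) / (sqrt (E $ j $ j) * sqrt (E $ k $ k))"
      by (simp only: sum_divide_distrib)
    also have "\<dots> = 0"
      using E(1) that unfolding entry diagonal_matrix_def by simp
    finally show ?thesis .
  qed
  moreover have "(\<Sum>i\<in>UNIV. (B j i)\<^sup>2) \<le> 1" for j
    using row[of j] unfolding W by simp
  ultimately show "(\<Sum>j\<in>UNIV. W j i) \<le> 1"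
    unfolding W by (rule orthogonal_rows_column_bound)
  show "(G $ j $ i)\<^sup>2 * D $ i $ i = W j i * E $ j $ j"
  proof (cases "E $ j $ j = 0")
    \<comment> \<open>A vanishing \<open>E $ j $ j\<close> is a sum of nonnegative terms, so every
      term is zero.\<close>
    case True
    then have "(G $ j $ i)\<^sup>2 * D $ i $ i = 0"
      using sum_nonneg_eq_0_iff[of UNIV "\<lambda>i. (G $ j $ i)\<^sup>2 * D $ i $ i"] diag[of j] D(2) by simp
    then show ?thesis using True by simp
  qed (simp add: W_def)
qed

lemma feasible_trace_le:
  fixes D :: "real^('p::{finite,linorder})^('p::{finite,linorder})"
    and E :: "real^('q::{finite,linorder})^('q::{finite,linorder})"
  assumes D: "diagonal_matrix D" "\<And>i. 0 \<le> D $ i $ i" "\<And>i j. i \<le> j \<Longrightarrow> D $ i $ i \<le> D $ j $ j"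
    and E: "diagonal_matrix E" "\<And>i. 0 \<le> E $ i $ i" "\<And>i j. i \<le> j \<Longrightarrow> E $ i $ i \<le> E $ j $ j"
    and G: "G ** D ** transpose G = E"
  shows "trace (G ** D ** D ** transpose G) \<le> trace (D ** transpose rect_id ** E ** rect_id)"
proof -
  note W = feasible_weights[OF D(1,2) E(1,2) G]
  have "trace (G ** D ** D ** transpose G) = (\<Sum>j\<in>UNIV. \<Sum>i\<in>UNIV. (G $ j $ i)\<^sup>2 * D $ i $ i * D $ i $ i)"
    unfolding trace_def matrix_mult_nth[of "G ** D ** D" "transpose G"]
    using D(1) by (simp add: diagonal_matrix_mult_right power2_eq_square mult_ac)
  also have "\<dots> = (\<Sum>j\<in>UNIV. \<Sum>i\<in>UNIV. ((G $ j $ i)\<^sup>2 * D $ i $ i / E $ j $ j) * (D $ i $ i * E $ j $ j))"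
    by (intro sum.cong refl, subst W(4)) (simp add: mult_ac)
  also have "\<dots> \<le> trace (D ** transpose rect_id ** E ** rect_id)"
    using W by (intro rearrangement_trace_le D E) simp_all
  finally show ?thesis .
qed

text \<open>Counting the total weight compares ranks: each row with a nonzero eigenvalue of
  \<open>E\<close> carries weight 1, and only columns with a nonzero eigenvalue of \<open>D\<close>
  carry weight, at most 1 each. In both orderings the nonzero eigenvalues occupy the top
  ranks.\<close>

lemma feasible_rank_condition:
  fixes D :: "real^('p::{finite,linorder})^('p::{finite,linorder})"
    and E :: "real^('q::{finite,linorder})^('q::{finite,linorder})"
  assumes D: "diagonal_matrix D" "\<And>i. 0 \<le> D $ i $ i" "\<And>i j. i \<le> j \<Longrightarrow> D $ i $ i \<le> D $ j $ j"
    and E: "diagonal_matrix E" "\<And>i. 0 \<le> E $ i $ i" "\<And>i j. i \<le> j \<Longrightarrow> E $ i $ i \<le> E $ j $ j"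
    and G: "G ** D ** transpose G = E" and j: "E $ j $ j \<noteq> 0"
  shows "\<exists>i. top_rank i = top_rank j \<and> D $ i $ i \<noteq> 0"
proof -
  note W = feasible_weights[OF D(1,2) E(1,2) G]
  let ?W = "\<lambda>j i. (G $ j $ i)\<^sup>2 * D $ i $ i / E $ j $ j"
  let ?P = "{i. D $ i $ i \<noteq> 0}" and ?Q = "{j. E $ j $ j \<noteq> 0}"
  have "real (card ?Q) = (\<Sum>j\<in>UNIV. \<Sum>i\<in>UNIV. ?W j i)"
    by (simp add: W(2) of_bool_def sum.If_cases)
  also have "\<dots> = (\<Sum>i\<in>UNIV. \<Sum>j\<in>UNIV. ?W j i)" by (rule sum.swap)
  also have "\<dots> = (\<Sum>i\<in>?P. \<Sum>j\<in>UNIV. ?W j i)"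
    by (rule sum.mono_neutral_right) auto
  also have "\<dots> \<le> (\<Sum>i\<in>?P. 1)" by (rule sum_mono) (rule W(3))
  finally have card: "card ?Q \<le> card ?P" by simp
  have "E $ j $ j > 0" using j E(2)[of j] by simp
  then have "{k. j \<le> k} \<subseteq> ?Q"
    using E(3)[of j] by (auto) (metis less_le_not_le)
  then have "card {k. j \<le> k} \<le> card ?P" using card by (meson card_mono finite le_trans)
  moreover have "{k. j \<le> k} = insert j {k. j < k}" by auto
  ultimately have less: "top_rank j < card ?P" by (simp add: top_rank_def)
  also have "card ?P \<le> CARD('p)" by (simp add: card_mono)
  finally have "top_rank j < CARD('p)" .
  then obtain i :: 'p where i: "top_rank i = top_rank j" using ex_top_rank by blast
  have "D $ i $ i \<noteq> 0"
  proof
    assume 0: "D $ i $ i = 0"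
    \<comment> \<open>By the ordering, a zero at \<open>i\<close> would leave only
      \<open>top_rank i\<close> places for nonzero eigenvalues, which is too few.\<close>
    have "?P \<subseteq> {k. i < k}"
    proof (rule subsetI, rule CollectI, rule ccontr)
      fix k assume "k \<in> ?P" "\<not> i < k"
      then show False using 0 D(2)[of k] D(3)[of k i] by (simp add: not_less)
    qed
    then have "card ?P \<le> top_rank i" unfolding top_rank_def by (simp add: card_mono)
    then show False using less i by simp
  qed
  then show ?thesis using i by blast
qed

section \<open>Linear maps between Gaussian measures\<close>

lemma matrix_sub_ldistrib: "(A::real^'b^'a) ** (B - C) = A ** B - A ** C"
  by (simp add: vec_eq_iff matrix_matrix_mult_def right_diff_distrib sum_subtractf)

lemma matrix_sub_rdistrib: "(B - C) ** (A::real^'c^'b) = B ** A - C ** A"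
  by (simp add: vec_eq_iff matrix_matrix_mult_def left_diff_distrib sum_subtractf)

lemma matrix_inv_eqI:
  fixes A B :: "real^'n^'n"
  assumes "A ** B = mat 1"
  shows "matrix_inv A = B"
proof -
  have "B ** A = mat 1" using assms by (simp add: matrix_left_right_inverse)
  then have ex: "\<exists>C. A ** C = mat 1 \<and> C ** A = mat 1" using assms by blast
  have "matrix_inv A ** A = mat 1"
    unfolding matrix_inv_def using someI_ex[OF ex] by blast
  then have "matrix_inv A = matrix_inv A ** (A ** B)" using assms by simp
  also have "\<dots> = B" using \<open>matrix_inv A ** A = mat 1\<close> by (simp add: matrix_mul_assoc)
  finally show ?thesis .
qed

lemma ordered_diagonalizationD:
  assumes "psd_matrix S" "ordered_diagonalization S V D"
  shows "orthogonal_matrix V" "diagonal_matrix D" "S = V ** D ** transpose V"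
    "\<And>i. 0 \<le> D $ i $ i" "\<And>i j. i \<le> j \<Longrightarrow> D $ i $ i \<le> D $ j $ j"
    "matrix_sqrt S = V ** map_diag sqrt D ** transpose V"
    "matrix_sqrt D = map_diag sqrt D"
proof -
  show V: "orthogonal_matrix V" and D: "diagonal_matrix D" and S: "S = V ** D ** transpose V"
    and "\<And>i j. i \<le> j \<Longrightarrow> D $ i $ i \<le> D $ j $ j"
    using assms(2) by (auto simp: ordered_diagonalization_def)
  show D0: "0 \<le> D $ i $ i" for i
    using assms(1) S V D by (intro psd_diagonalization_nonneg) simp
  show "matrix_sqrt S = V ** map_diag sqrt D ** transpose V"
    unfolding S by (rule matrix_sqrt_diagonalization[OF V D D0])
  show "matrix_sqrt D = map_diag sqrt D"
    using matrix_sqrt_diagonalization[of "mat 1" D, OF _ D D0] by (simp add: orthogonal_matrix_def)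
qed

lemma matrix_sqrt_psd:
  assumes "psd_matrix S" "ordered_diagonalization S V D"
  shows "transpose (matrix_sqrt S) = matrix_sqrt S" "matrix_sqrt S ** matrix_sqrt S = S"
proof -
  note od = ordered_diagonalizationD[OF assms]
  show "transpose (matrix_sqrt S) = matrix_sqrt S"
    unfolding od(6) using psd_orthogonal_conjugate[of "map_diag sqrt D" V] od(4)
    by (simp add: psd_matrix_def map_diag_nth)
  have "matrix_sqrt S ** matrix_sqrt S = V ** (map_diag sqrt D ** map_diag sqrt D) ** transpose V"
    unfolding od(6) by (simp add: matrix_mul_assoc orthogonal_matrix_cancel[OF od(1)])
  then show "matrix_sqrt S ** matrix_sqrt S = S"
    using od(2,4) by (simp add: map_diag_sqrt_square od(3)[symmetric])
qed

text \<open>A zero eigenvalue would put the nonzero vector \<open>V *v axis i 1\<close> into the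
  kernel.\<close>

lemma invertible_diagonalization_nonzero:
  assumes "invertible (V ** D ** transpose V)" "orthogonal_matrix V" "diagonal_matrix D"
  shows "D $ i $ i \<noteq> 0"
proof
  assume 0: "D $ i $ i = 0"
  have "column i D = 0"
    using 0 assms(3) by (auto simp: vec_eq_iff column_def diagonal_matrix_def) metis
  then have Dv: "D *v axis i 1 = 0" by (simp add: matrix_vector_mult_basis)
  obtain B where B: "B ** (V ** D ** transpose V) = mat 1"
    using assms(1) by (auto simp: invertible_def)
  have "V *v axis i 1 = (B ** (V ** D ** transpose V) ** V) *v axis i 1"
    by (simp add: B)
  also have "\<dots> = (B ** V) *v (D *v axis i 1)"
    by (simp add: matrix_mul_assoc orthogonal_matrix_cancel[OF assms(2)] matrix_vector_mul_assoc)
  also have "\<dots> = 0" by (simp add: Dv)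
  finally have "transpose V *v (V *v axis i 1) = 0" by simp
  then have "axis i (1::real) = 0"
    using assms(2) by (simp add: matrix_vector_mul_assoc orthogonal_matrix_def del: transpose_matrix_vector)
  then show False by (simp add: axis_eq_0_iff)
qed

section \<open>Covariances and the cost of linear maps\<close>

lemma distr_gaussian_measure:
  fixes A :: "real^'p^'q"
  shows "distr (gaussian_measure S) borel ((*v) A) = distr std_gaussian borel ((*v) (A ** matrix_sqrt S))"
  unfolding gaussian_measure_def
  by (subst distr_distr) (auto simp: comp_def matrix_vector_mul_assoc)

lemma std_gaussian_image_second_moment:
  fixes C :: "real^'p^'q"
  shows "(\<integral>y. y $ i * y $ j \<partial>(distr std_gaussian borel ((*v) C))) = (C ** transpose C) $ i $ j"
proof -
  have "(\<integral>y. y $ i * y $ j \<partial>(distr std_gaussian borel ((*v) C)))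
      = (\<integral>z. (C *v z) $ i * (C *v z) $ j \<partial>std_gaussian)"
    by (subst integral_distr) auto
  also have "\<dots> = (\<integral>z. (\<Sum>k\<in>UNIV. \<Sum>l\<in>UNIV. C $ i $ k * C $ j $ l * (z $ k * z $ l)) \<partial>std_gaussian)"
    by (simp add: matrix_vector_mult_def sum_product mult_ac)
  also have "\<dots> = (\<Sum>k\<in>UNIV. \<Sum>l\<in>UNIV. C $ i $ k * C $ j $ l * of_bool (k = l))"
    by (intro has_bochner_integral_integral_eq has_bochner_integral_sum
      has_bochner_integral_mult_right std_gaussian_moment2)
  finally show ?thesis
    by (simp add: of_bool_sum_delta matrix_mult_nth)
qed

text \<open>Second moments are determined by the law. Only this direction enters, giving the
  necessary condition for feasibility; the optimal map has its push-forward verified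
  directly.\<close>

lemma std_gaussian_image_eqD:
  fixes C :: "real^'p^'q" and R :: "real^'r^'q"
  assumes "distr std_gaussian borel ((*v) C) = distr std_gaussian borel ((*v) R)"
  shows "C ** transpose C = R ** transpose R"
  using std_gaussian_image_second_moment[of C] std_gaussian_image_second_moment[of R] assms
  by (simp add: vec_eq_iff)

text \<open>The matrix \<open>K = C^T C\<close> has the same trace and the same trace of its square
  as \<open>S' = C C^T\<close>. The coefficient 16 is 8 times the factor 2 of the cross term in
  \<open>trace (N ** N)\<close>.\<close>

lemma gm_cost_gaussian:
  fixes S :: "real^'p^'p" and A :: "real^'p^'q"
  assumes R: "transpose (matrix_sqrt S) = matrix_sqrt S" "matrix_sqrt S ** matrix_sqrt S = S"
    and A: "A ** S ** transpose A = S'"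
  shows "gm_cost (gaussian_measure S) ((*v) A) = ereal (4 * (trace S - trace S')\<^sup>2
    + 8 * (trace (S ** S) + trace (S' ** S')) - 16 * trace (A ** S ** S ** transpose A))"
proof -
  define R where "R = matrix_sqrt S"
  define C where "C = A ** R"
  define K where "K = transpose C ** C"
  define N where "N = S - K"
  have R': "transpose R = R" "R ** R = S" using R by (simp_all add: R_def)
  have SR: "S ** R = R ** S" using R'(2) by (metis matrix_mul_assoc)
  have CC: "C ** transpose C = S'"
  proof -
    have "C ** transpose C = A ** (R ** R) ** transpose A"
      by (simp add: C_def matrix_transpose_mul R' matrix_mul_assoc del: R'(2))
    then show ?thesis using A R' by simp
  qed
  \<comment> \<open>Since \<open>R\<close> commutes with its square \<open>S\<close>, the two outer
    copies of \<open>R\<close> merge into a second factor \<open>S\<close>.\<close>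
  have CSC: "C ** S ** transpose C = A ** S ** S ** transpose A"
  proof -
    have "C ** S ** transpose C = A ** (R ** S) ** R ** transpose A"
      by (simp add: C_def matrix_transpose_mul R'(1) matrix_mul_assoc)
    also have "\<dots> = A ** S ** (R ** R) ** transpose A"
      unfolding SR[symmetric] by (simp only: matrix_mul_assoc)
    finally show ?thesis by (simp only: R'(2))
  qed
  have tS: "transpose S = S"
    using R' by (metis matrix_transpose_mul)
  have tN: "transpose N = N"
    using tS by (simp add: N_def K_def vec_eq_iff) (metis matrix_transpose_mul transpose_nth transpose_transpose)
  have trN: "trace N = trace S - trace S'"
    by (simp add: N_def K_def trace_sub trace_mul_sym[of "transpose C"] CC)
  have SK: "trace (S ** K) = trace (A ** S ** S ** transpose A)"
    using trace_mul_sym[of "S ** transpose C" C] by (simp add: K_def matrix_mul_assoc CSC)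
  have KK: "trace (K ** K) = trace (S' ** S')"
  proof -
    have "trace (K ** K) = trace (transpose C ** (S' ** C))"
      by (simp add: K_def matrix_mul_assoc flip: CC)
    also have "\<dots> = trace (S' ** (C ** transpose C))"
      unfolding trace_mul_sym[of "transpose C" "S' ** C"] by (simp only: matrix_mul_assoc)
    finally show ?thesis by (simp add: CC)
  qed
  have trNN: "trace (N ** N) = trace (S ** S) - 2 * trace (A ** S ** S ** transpose A) + trace (S' ** S')"
    by (simp add: N_def matrix_sub_ldistrib matrix_sub_rdistrib trace_sub KK SK trace_mul_sym[of K S])
  have pt: "((norm (R *v z - R *v z'))\<^sup>2 - (norm (A *v (R *v z) - A *v (R *v z')))\<^sup>2)\<^sup>2
      = ((z - z') \<bullet> (N *v (z - z')))\<^sup>2" for z z'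
  proof -
    define y where "y = z - z'"
    have "R *v z - R *v z' = R *v y" "A *v (R *v z) - A *v (R *v z') = C *v y"
      by (simp_all add: y_def C_def matrix_vector_mult_diff_distrib matrix_vector_mul_assoc)
    moreover have "(norm (R *v y))\<^sup>2 = y \<bullet> (S *v y)"
      unfolding power2_norm_eq_inner inner_matrix_vector_transpose[of "R *v y"]
      by (simp only: R' matrix_vector_mul_assoc inner_commute)
    moreover have "(norm (C *v y))\<^sup>2 = y \<bullet> (K *v y)"
      unfolding power2_norm_eq_inner inner_matrix_vector_transpose[of "C *v y"] K_def
      by (simp only: matrix_vector_mul_assoc inner_commute)
    ultimately show ?thesis
      unfolding y_def[symmetric] by (simp add: N_def matrix_vector_mult_diff_rdistrib inner_diff_right)
  qed
  have "(\<integral>\<^sup>+ x. \<integral>\<^sup>+ x'. ennreal (((norm (x - x'))\<^sup>2 - (norm (A *v x - A *v x'))\<^sup>2)\<^sup>2)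
        \<partial>gaussian_measure S \<partial>gaussian_measure S)
      = (\<integral>\<^sup>+z. \<integral>\<^sup>+z'. ennreal (((z - z') \<bullet> (N *v (z - z')))\<^sup>2) \<partial>std_gaussian \<partial>std_gaussian)"
  proof -
    interpret prob_space "std_gaussian :: (real^'p) measure" by (rule prob_space_std_gaussian)
    have meas: "(\<lambda>x. \<integral>\<^sup>+z'. ennreal (((norm (x - R *v z'))\<^sup>2 - (norm (A *v x - A *v (R *v z')))\<^sup>2)\<^sup>2) \<partial>std_gaussian)
        \<in> borel_measurable borel"
      by (rule borel_measurable_nn_integral) measurable
    show ?thesis
      unfolding gaussian_measure_def R_def[symmetric]
      by (simp add: nn_integral_distr meas pt)
  qed
  also have "\<dots> = ennreal (4 * (trace N)\<^sup>2 + 8 * trace (N ** N))"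
    by (rule std_gaussian_expected_square_difference[OF tN])
  finally have "gm_cost (gaussian_measure S) ((*v) A) = enn2ereal (ennreal (4 * (trace N)\<^sup>2 + 8 * trace (N ** N)))"
    by (simp add: gm_cost_def)
  \<comment> \<open>A negative value would be truncated by \<open>ennreal\<close>.\<close>
  moreover have "0 \<le> trace (N ** N)"
    unfolding trace_def matrix_mult_nth using tN
    by (intro sum_nonneg) (metis transpose_nth zero_le_square)
  ultimately have "gm_cost (gaussian_measure S) ((*v) A) = ereal (4 * (trace N)\<^sup>2 + 8 * trace (N ** N))"
    by (simp del: ennreal_plus)
  then show ?thesis by (simp add: trN trNN algebra_simps)
qed

lemma linear_monge_map_covariance:
  fixes S V D :: "real^('p::{finite,linorder})^('p::{finite,linorder})"
    and S' V' D' :: "real^('q::{finite,linorder})^('q::{finite,linorder})"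
  assumes S: "psd_matrix S" "ordered_diagonalization S V D"
    and S': "psd_matrix S'" "ordered_diagonalization S' V' D'"
    and T: "T \<in> linear_monge_maps (gaussian_measure S) (gaussian_measure S')"
  shows "T = (*v) (matrix T)" "matrix T ** S ** transpose (matrix T) = S'"
proof -
  have lin: "linear T" and push: "distr (gaussian_measure S) borel T = gaussian_measure S'"
    using T by (auto simp: linear_monge_maps_def)
  show TA: "T = (*v) (matrix T)" using lin by (auto simp: matrix_works)
  define A where "A = matrix T"
  let ?R = "matrix_sqrt S" and ?R' = "matrix_sqrt S'"
  have "distr std_gaussian borel ((*v) (A ** ?R)) = distr std_gaussian borel ((*v) ?R')"
    using push distr_gaussian_measure[of S A] TA by (simp add: A_def gaussian_measure_def)
  then have "(A ** ?R) ** transpose (A ** ?R) = ?R' ** transpose ?R'"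
    by (rule std_gaussian_image_eqD)
  then have "A ** (?R ** ?R) ** transpose A = S'"
    by (simp add: matrix_sqrt_psd[OF S'] matrix_sqrt_psd(1)[OF S] matrix_transpose_mul matrix_mul_assoc)
  then show "matrix T ** S ** transpose (matrix T) = S'"
    by (simp add: matrix_sqrt_psd[OF S] A_def)
qed

lemma diagonalized_covariance:
  fixes V D :: "real^'p^'p" and V' D' :: "real^'q^'q" and A :: "real^'p^'q"
  assumes V: "orthogonal_matrix V" and V': "orthogonal_matrix V'"
    and A: "A ** (V ** D ** transpose V) ** transpose A = V' ** D' ** transpose V'"
  defines "G \<equiv> transpose V' ** A ** V"
  shows "G ** D ** transpose G = D'"
    "trace (A ** (V ** D ** transpose V) ** (V ** D ** transpose V) ** transpose A) = trace (G ** D ** D ** transpose G)"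
proof -
  have "G ** D ** transpose G = transpose V' ** (A ** (V ** D ** transpose V) ** transpose A) ** V'"
    by (simp add: G_def matrix_transpose_mul matrix_mul_assoc)
  also have "\<dots> = D'"
    unfolding A by (simp add: matrix_mul_assoc orthogonal_matrix_cancel[OF V'])
      (use V' in \<open>simp add: orthogonal_matrix_def\<close>)
  finally show "G ** D ** transpose G = D'" .
  have "trace (G ** D ** D ** transpose G) = trace (transpose V' ** (A ** V ** D ** D ** transpose V ** transpose A ** V'))"
    by (simp add: G_def matrix_transpose_mul matrix_mul_assoc)
  also have "\<dots> = trace (A ** V ** D ** D ** transpose V ** transpose A)"
    unfolding trace_mul_sym[of "transpose V'"] by (simp add: orthogonal_matrix_cancel[OF V'])
  also have "\<dots> = trace (A ** (V ** D ** transpose V) ** (V ** D ** transpose V) ** transpose A)"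
    by (simp add: matrix_mul_assoc orthogonal_matrix_cancel[OF V])
  finally show "trace (A ** (V ** D ** transpose V) ** (V ** D ** transpose V) ** transpose A) = trace (G ** D ** D ** transpose G)"
    by simp
qed

text \<open>Since \<open>x / 0 = 0\<close>, the factor \<open>1 / sqrt (D $ i $ i)\<close> acts as a pseudo-inverse when \<open>D\<close> is singular.\<close>

definition comonotone_coupling ::
    "real^('p::{finite,linorder})^('p::{finite,linorder}) \<Rightarrow> real^('q::{finite,linorder})^('q::{finite,linorder})
      \<Rightarrow> real^('p::{finite,linorder})^('q::{finite,linorder})" where
  "comonotone_coupling D E = (\<chi> j i. rect_id $ j $ i * (sqrt (E $ j $ j) / sqrt (D $ i $ i)))"

text \<open>The pseudo-inverse cancels against the root of \<open>D\<close> except where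
  \<open>D\<close> vanishes; by the rank condition, \<open>E\<close> vanishes at the matched index
  there as well.\<close>

lemma comonotone_coupling_mult_sqrt:
  fixes D :: "real^('p::{finite,linorder})^('p::{finite,linorder})"
    and E :: "real^('q::{finite,linorder})^('q::{finite,linorder})"
  assumes rank: "\<And>j. E $ j $ j \<noteq> 0 \<Longrightarrow> \<exists>i. top_rank i = top_rank j \<and> D $ i $ i \<noteq> 0"
  shows "(comonotone_coupling D E ** map_diag sqrt D) $ j $ i = rect_id $ j $ i * sqrt (E $ j $ j)"
proof (cases "top_rank j = top_rank i \<and> E $ j $ j \<noteq> 0")
  case True
  then have "D $ i $ i \<noteq> 0" using rank[of j] by auto
  then show ?thesis
    by (simp add: diagonal_matrix_mult_right comonotone_coupling_def map_diag_nth)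
qed (auto simp: diagonal_matrix_mult_right comonotone_coupling_def map_diag_nth rect_id_nth)

lemma comonotone_coupling_trace:
  fixes D :: "real^('p::{finite,linorder})^('p::{finite,linorder})"
    and E :: "real^('q::{finite,linorder})^('q::{finite,linorder})"
  assumes D: "diagonal_matrix D" "\<And>i. 0 \<le> D $ i $ i" and E: "diagonal_matrix E" "\<And>i. 0 \<le> E $ i $ i"
  shows "trace (comonotone_coupling D E ** D ** D ** transpose (comonotone_coupling D E))
    = trace (D ** transpose rect_id ** E ** rect_id)"
proof -
  let ?G = "comonotone_coupling D E"
  have "trace (?G ** D ** D ** transpose ?G) = (\<Sum>j\<in>UNIV. \<Sum>i\<in>UNIV. (?G $ j $ i)\<^sup>2 * (D $ i $ i)\<^sup>2)"
    unfolding trace_def matrix_mult_nth[of "?G ** D ** D" "transpose ?G"]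
    using D(1) by (simp add: diagonal_matrix_mult_right power2_eq_square mult_ac)
  also have "\<dots> = (\<Sum>j\<in>UNIV. \<Sum>i\<in>UNIV. (rect_id $ j $ i)\<^sup>2 * (D $ i $ i * E $ j $ j))"
  proof (intro sum.cong refl)
    fix j :: 'q and i :: 'p
    show "(?G $ j $ i)\<^sup>2 * (D $ i $ i)\<^sup>2 = (rect_id $ j $ i)\<^sup>2 * (D $ i $ i * E $ j $ j)"
      using D(2)[of i] E(2)[of j]
      by (cases "D $ i $ i = 0")
        (auto simp: comonotone_coupling_def power_mult_distrib power_divide, simp add: power2_eq_square)
  qed
  also have "\<dots> = trace (D ** transpose rect_id ** E ** rect_id)"
    using D E by (simp add: trace_diagonal_quadratic)
  finally show ?thesis .
qed

lemma distr_std_gaussian_mult: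
  fixes A :: "real^'b^'c" and B :: "real^'a^'b"
  shows "distr std_gaussian borel ((*v) (A ** B)) = distr (distr std_gaussian borel ((*v) B)) borel ((*v) A)"
  by (subst distr_distr) (auto simp: comp_def matrix_vector_mul_assoc)

text \<open>Both matrices send \<open>z\<close> to scaled coordinates with the same coefficients,
  selected by \<open>g\<close> on one side and by \<open>id\<close> on the other, so their laws
  coincide.\<close>

lemma comonotone_coupling_push_forward:
  fixes D :: "real^('p::{finite,linorder})^('p::{finite,linorder})"
    and E :: "real^('q::{finite,linorder})^('q::{finite,linorder})"
  assumes E: "diagonal_matrix E"
    and rank: "\<And>j. E $ j $ j \<noteq> 0 \<Longrightarrow> \<exists>i. top_rank i = top_rank j \<and> D $ i $ i \<noteq> 0"
  shows "distr std_gaussian borel ((*v) (comonotone_coupling D E ** map_diag sqrt D))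
    = distr std_gaussian borel ((*v) (map_diag sqrt E))"
proof -
  let ?H = "comonotone_coupling D E ** map_diag sqrt D"
  define c :: "real^('q::{finite,linorder})" where "c = (\<chi> j. sqrt (E $ j $ j))"
  \<comment> \<open>The value of \<open>g j\<close> is arbitrary when no index has the same rank;
    the coefficient is zero in that case.\<close>
  define g :: "'q \<Rightarrow> 'p::{finite,linorder}" where "g j = (SOME i. top_rank i = top_rank j)" for j
  have g: "top_rank (g j) = top_rank j" if "c $ j \<noteq> 0" for j
  proof -
    have "\<exists>i::'p. top_rank i = top_rank j" using rank[of j] that by (auto simp: c_def)
    then show ?thesis unfolding g_def by (rule someI_ex)
  qed
  have "inj_on g {j. c $ j \<noteq> 0}"
  proof (rule inj_onI)
    fix j k assume jk: "j \<in> {j. c $ j \<noteq> 0}" "k \<in> {j. c $ j \<noteq> 0}" "g j = g k"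
    have "top_rank (g j) = top_rank j" "top_rank (g k) = top_rank k"
      using jk by (intro g; simp)+
    with jk(3) have "top_rank j = top_rank k" by (simp only:)
    then show "j = k" by (rule top_rank_eq_iff[THEN iffD1])
  qed
  have H: "(?H *v z) $ j = c $ j * z $ g j" for z j
  proof (cases "c $ j = 0")
    case True
    then show ?thesis
      by (simp add: matrix_vector_mult_def comonotone_coupling_mult_sqrt[OF rank] c_def)
  next
    case False
    have "top_rank j = top_rank i \<longleftrightarrow> i = g j" for i
      using g[OF False] top_rank_eq_iff[of "g j" i] by auto
    then have "?H $ j $ i * z $ i = (if i = g j then c $ j * z $ i else 0)" for i
      by (simp add: comonotone_coupling_mult_sqrt[OF rank] rect_id_nth c_def)
    then have "(?H *v z) $ j = (\<Sum>i\<in>UNIV. if i = g j then c $ j * z $ i else 0)"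
      by (simp only: matrix_vector_mult_def vec_lambda_beta)
    then show ?thesis by simp
  qed
  have "(map_diag sqrt E *v z) $ j = c $ j * z $ j" for z j
  proof -
    have "map_diag sqrt E $ j $ i * z $ i = (if i = j then c $ j * z $ j else 0)" for i
      by (simp add: map_diag_nth c_def)
    then have "(map_diag sqrt E *v z) $ j = (\<Sum>i\<in>UNIV. if i = j then c $ j * z $ j else 0)"
      by (simp only: matrix_vector_mult_def vec_lambda_beta)
    then show ?thesis by simp
  qed
  then have "(*v) (map_diag sqrt E) = (\<lambda>z. \<chi> j. c $ j * z $ id j)"
    by (simp add: fun_eq_iff vec_eq_iff)
  moreover have "(*v) ?H = (\<lambda>z. \<chi> j. c $ j * z $ g j)"
    by (simp add: fun_eq_iff vec_eq_iff H)
  ultimately show ?thesis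
    using std_gaussian_subvector[OF \<open>inj_on g {j. c $ j \<noteq> 0}\<close>] std_gaussian_subvector[of id c] by simp
qed

section \<open>The optimal map and the optimal value\<close>

lemma LGM_gaussian:
  fixes S V D :: "real^('p::{finite,linorder})^('p::{finite,linorder})"
    and S' V' D' :: "real^('q::{finite,linorder})^('q::{finite,linorder})"
  assumes S: "psd_matrix S" "ordered_diagonalization S V D"
    and S': "psd_matrix S'" "ordered_diagonalization S' V' D'"
    and rank: "\<And>j. D' $ j $ j \<noteq> 0 \<Longrightarrow> \<exists>i. top_rank i = top_rank j \<and> D $ i $ i \<noteq> 0"
  shows "optimal_linear_monge_map (gaussian_measure S) (gaussian_measure S')
      ((*v) (V' ** comonotone_coupling D D' ** transpose V))" (is ?opt)
    and "LGM2_sq (gaussian_measure S) (gaussian_measure S') =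
      ereal (4 * (trace S - trace S')\<^sup>2 + 8 * (trace (S ** S) + trace (S' ** S'))
        - 16 * trace (D ** transpose rect_id ** D' ** rect_id))" (is "_ = ereal ?c")
proof -
  note s = ordered_diagonalizationD[OF S] and s' = ordered_diagonalizationD[OF S']
  let ?G = "comonotone_coupling D D'"
  let ?A = "V' ** ?G ** transpose V"
  let ?maps = "linear_monge_maps (gaussian_measure S) (gaussian_measure S')"
  have rotS: "orthogonal_matrix (transpose V)" and rotS': "orthogonal_matrix (transpose V')"
    using s(1) s'(1) by simp_all
  have "distr (gaussian_measure S) borel ((*v) ?A)
      = distr std_gaussian borel ((*v) (V' ** (?G ** map_diag sqrt D) ** transpose V))"
    unfolding distr_gaussian_measure s(6) by (simp add: matrix_mul_assoc orthogonal_matrix_cancel[OF s(1)])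
  \<comment> \<open>A rotation acting first on the standard Gaussian can be deleted; below, a
    different one is inserted to form the square root of \<open>S'\<close>.\<close>
  also have "\<dots> = distr (distr std_gaussian borel ((*v) (?G ** map_diag sqrt D))) borel ((*v) V')"
    by (simp only: distr_std_gaussian_mult std_gaussian_rotation[OF rotS])
  also have "distr std_gaussian borel ((*v) (?G ** map_diag sqrt D)) = distr std_gaussian borel ((*v) (map_diag sqrt D'))"
    by (rule comonotone_coupling_push_forward[OF s'(2) rank])
  also have "distr (distr std_gaussian borel ((*v) (map_diag sqrt D'))) borel ((*v) V')
      = distr std_gaussian borel ((*v) (V' ** map_diag sqrt D' ** transpose V'))"
    by (simp only: distr_std_gaussian_mult std_gaussian_rotation[OF rotS'])
  also have "\<dots> = gaussian_measure S'"
    by (simp add: gaussian_measure_def s'(6))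
  finally have maps: "(*v) ?A \<in> ?maps"
    by (simp add: linear_monge_maps_def)
  have cost: "gm_cost (gaussian_measure S) ((*v) A) = ereal (4 * (trace S - trace S')\<^sup>2
      + 8 * (trace (S ** S) + trace (S' ** S')) - 16 * trace ((transpose V' ** A ** V) ** D ** D ** transpose (transpose V' ** A ** V)))"
      and feas: "(transpose V' ** A ** V) ** D ** transpose (transpose V' ** A ** V) = D'"
    if "(*v) A \<in> ?maps" for A
  proof -
    have A: "A ** S ** transpose A = S'"
      using linear_monge_map_covariance(2)[OF S S' that] by simp
    note dc = diagonalized_covariance[OF s(1) s'(1) A[unfolded s(3) s'(3)]]
    show "(transpose V' ** A ** V) ** D ** transpose (transpose V' ** A ** V) = D'"
      by (rule dc(1))
    show "gm_cost (gaussian_measure S) ((*v) A) = ereal (4 * (trace S - trace S')\<^sup>2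
      + 8 * (trace (S ** S) + trace (S' ** S')) - 16 * trace ((transpose V' ** A ** V) ** D ** D ** transpose (transpose V' ** A ** V)))"
      unfolding gm_cost_gaussian[OF matrix_sqrt_psd[OF S] A] using dc(2) by (simp add: s(3)[symmetric])
  qed
  have "transpose V' ** ?A ** V = ?G"
    by (simp add: matrix_mul_assoc[symmetric] orthogonal_matrix_cancel[OF s'(1)])
      (use s(1) in \<open>simp add: orthogonal_matrix_def\<close>)
  then have opt_cost: "gm_cost (gaussian_measure S) ((*v) ?A) = ereal ?c"
    using cost[OF maps] comonotone_coupling_trace[OF s(2,4) s'(2,4)] by simp
  have lower: "ereal ?c \<le> gm_cost (gaussian_measure S) T" if "T \<in> ?maps" for T
  proof -
    have T: "T = (*v) (matrix T)" by (rule linear_monge_map_covariance(1)[OF S S' that])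
    then have mT: "(*v) (matrix T) \<in> ?maps" using that by simp
    show ?thesis
      using cost[OF mT] feasible_trace_le[OF s(2,4,5) s'(2,4,5) feas[OF mT]] by (subst T) simp
  qed
  have "(INF T\<in>?maps. gm_cost (gaussian_measure S) T) = ereal ?c"
    using maps lower by (intro antisym INF_greatest INF_lower2[of "(*v) ?A"]) (simp_all add: opt_cost)
  then show LGM: "LGM2_sq (gaussian_measure S) (gaussian_measure S') = ereal ?c"
    by (simp add: LGM2_sq_def)
  show ?opt
    using maps by (simp add: optimal_linear_monge_map_def opt_cost LGM)
qed

text \<open>The rank condition has two sources: an existing feasible map, or an invertible
  \<open>S\<close> in a dimension at least that of the target, where every matched eigenvalue of
  \<open>S\<close> is nonzero.\<close>

lemma LGM_gaussian_rank_condition: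
  fixes S V D :: "real^('p::{finite,linorder})^('p::{finite,linorder})"
    and S' V' D' :: "real^('q::{finite,linorder})^('q::{finite,linorder})"
  assumes S: "psd_matrix S" "ordered_diagonalization S V D"
    and S': "psd_matrix S'" "ordered_diagonalization S' V' D'"
    and feasible: "linear_monge_maps (gaussian_measure S) (gaussian_measure S') \<noteq> {} \<or>
      invertible S \<and> CARD('q) \<le> CARD('p)"
    and j: "D' $ j $ j \<noteq> 0"
  shows "\<exists>i. top_rank i = top_rank j \<and> D $ i $ i \<noteq> 0"
proof -
  note s = ordered_diagonalizationD[OF S] and s' = ordered_diagonalizationD[OF S']
  from feasible show ?thesis
  proof
    assume "linear_monge_maps (gaussian_measure S) (gaussian_measure S') \<noteq> {}"
    then obtain T where "T \<in> linear_monge_maps (gaussian_measure S) (gaussian_measure S')" by blast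
    from linear_monge_map_covariance(2)[OF S S' this]
    have "(transpose V' ** matrix T ** V) ** D ** transpose (transpose V' ** matrix T ** V) = D'"
      by (intro diagonalized_covariance(1) s(1) s'(1)) (simp only: s(3)[symmetric] s'(3)[symmetric])
    from feasible_rank_condition[OF s(2,4,5) s'(2,4,5) this j] show ?thesis .
  next
    assume inv: "invertible S \<and> CARD('q) \<le> CARD('p)"
    then have "top_rank j < CARD('p)" using top_rank_less_card[of j] by simp
    then obtain i :: 'p where "top_rank i = top_rank j" using ex_top_rank by blast
    moreover have "D $ i $ i \<noteq> 0"
      using inv s by (intro invertible_diagonalization_nonzero[of V]) simp_all
    ultimately show ?thesis by blast
  qed
qed

text \<open>The constraint is a predicate \<open>P\<close> so that one proof serves the Stiefel set
  and the set of matrices with Stiefel transpose.\<close>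

lemma rect_id_is_arg_min:
  fixes D :: "real^('p::{finite,linorder})^('p::{finite,linorder})"
    and E :: "real^('q::{finite,linorder})^('q::{finite,linorder})"
  assumes D: "diagonal_matrix D" "\<And>i. 0 \<le> D $ i $ i" "\<And>i j. i \<le> j \<Longrightarrow> D $ i $ i \<le> D $ j $ j"
    and E: "diagonal_matrix E" "\<And>i. 0 \<le> E $ i $ i" "\<And>i j. i \<le> j \<Longrightarrow> E $ i $ i \<le> E $ j $ j"
    and P: "P rect_id" "\<And>B. P B \<Longrightarrow> B \<in> stiefel \<or> transpose B \<in> stiefel"
  shows "is_arg_min (\<lambda>B. - trace (D ** transpose B ** E ** B)) P rect_id"
proof -
  have "trace (D ** transpose B ** E ** B) \<le> trace (D ** transpose rect_id ** E ** rect_id)" if "P B" for B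
    unfolding trace_diagonal_quadratic[OF D(1) E(1), of B]
    using stiefel_substochastic[OF P(2)[OF that]] by (intro rearrangement_trace_le D E) simp_all
  then show ?thesis using P(1) by (auto simp: is_arg_min_def not_less)
qed

text \<open>On a single index type \<open>rect_id\<close> is the identity, so
  \<open>comonotone_coupling\<close> becomes a product of diagonal roots. The second formula follows
  by cancelling the eigenbases.\<close>

lemma square_gaussian_optimal_matrix:
  fixes S V D S' V' D' :: "real^('n::{finite,linorder})^('n::{finite,linorder})"
  assumes S: "psd_matrix S" "ordered_diagonalization S V D"
    and S': "psd_matrix S'" "ordered_diagonalization S' V' D'"
    and inv: "invertible S"
  shows "V' ** matrix_sqrt D' ** matrix_inv_sqrt D ** transpose V = V' ** comonotone_coupling D D' ** transpose V"
    and "V' ** matrix_sqrt D' ** matrix_inv_sqrt D ** transpose V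
      = matrix_sqrt S' ** V' ** transpose V ** matrix_inv_sqrt S"
proof -
  note s = ordered_diagonalizationD[OF S] and s' = ordered_diagonalizationD[OF S']
  let ?I = "map_diag (\<lambda>x. 1 / sqrt x) D"
  have pos: "0 < D $ i $ i" for i
    using invertible_diagonalization_nonzero[of V D i] inv s(1,2,3) s(4)[of i] by simp
  have one: "map_diag sqrt D ** ?I = mat 1"
    using pos by (auto simp: vec_eq_iff diagonal_matrix_mult_right map_diag_nth mat_def)
      (metis less_irrefl)
  have invD: "matrix_inv_sqrt D = ?I"
    unfolding s(7) by (rule matrix_inv_eqI[OF one])
  have invS: "matrix_inv_sqrt S = V ** ?I ** transpose V"
    unfolding s(6)
  proof (rule matrix_inv_eqI)
    have "V ** map_diag sqrt D ** transpose V ** (V ** ?I ** transpose V)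
        = V ** (map_diag sqrt D ** ?I) ** transpose V"
      by (simp add: matrix_mul_assoc orthogonal_matrix_cancel[OF s(1)])
    then show "V ** map_diag sqrt D ** transpose V ** (V ** ?I ** transpose V) = mat 1"
      using s(1) by (simp add: one orthogonal_matrix_def)
  qed
  have "map_diag sqrt D' ** ?I = comonotone_coupling D D'"
    by (auto simp: vec_eq_iff diagonal_matrix_mult_right map_diag_nth comonotone_coupling_def rect_id_nth)
  then show "V' ** matrix_sqrt D' ** matrix_inv_sqrt D ** transpose V = V' ** comonotone_coupling D D' ** transpose V"
    unfolding invD s'(7) by (metis matrix_mul_assoc)
  show "V' ** matrix_sqrt D' ** matrix_inv_sqrt D ** transpose V
      = matrix_sqrt S' ** V' ** transpose V ** matrix_inv_sqrt S"
    unfolding invD invS s'(6,7)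
    by (simp add: matrix_mul_assoc orthogonal_matrix_cancel[OF s(1)] orthogonal_matrix_cancel[OF s'(1)])
qed

text \<open>For q < p no matrix satisfies \<open>B^T B = 1\<close>, so there the transpose is taken
  in the Stiefel set. Without a feasible map the infimum is infinite; for q < p an invertible source
  covariance provides one. The square case has its own index type so that products such as
  \<open>D\<mu>' ** D\<nu>'\<close> are well typed.\<close>

theorem theorem4p2p6:
  fixes S\<mu> V\<mu> D\<mu> :: "real^('p::{finite,linorder})^('p::{finite,linorder})"
    and S\<nu> V\<nu> D\<nu> :: "real^('q::{finite,linorder})^('q::{finite,linorder})"
    and S\<mu>' V\<mu>' D\<mu>' S\<nu>' V\<nu>' D\<nu>' :: "real^('n::{finite,linorder})^('n::{finite,linorder})"
  assumes "psd_matrix S\<mu>" and "psd_matrix S\<nu>"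
    and "ordered_diagonalization S\<mu> V\<mu> D\<mu>" and "ordered_diagonalization S\<nu> V\<nu> D\<nu>"
    and "psd_matrix S\<mu>'" and "psd_matrix S\<nu>'"
    and "ordered_diagonalization S\<mu>' V\<mu>' D\<mu>'" and "ordered_diagonalization S\<nu>' V\<nu>' D\<nu>'"
  shows
    "(CARD('p) < CARD('q) \<and>
     linear_monge_maps (gaussian_measure S\<mu>) (gaussian_measure S\<nu>) \<noteq> {} \<longrightarrow>
       (\<exists>B :: real^('p::{finite,linorder})^('q::{finite,linorder}).
          is_arg_min (\<lambda>B. - trace (D\<mu> ** transpose B ** D\<nu> ** B)) (\<lambda>B. B \<in> stiefel) B \<and>
          LGM2_sq (gaussian_measure S\<mu>) (gaussian_measure S\<nu>) =
            ereal (4 * (trace S\<mu> - trace S\<nu>)\<^sup>2 + 8 * (trace (S\<mu> ** S\<mu>) + trace (S\<nu> ** S\<nu>))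
              + 16 * (- trace (D\<mu> ** transpose B ** D\<nu> ** B))))) \<and>
     (CARD('q) < CARD('p) \<and>
     (invertible S\<mu> \<or> linear_monge_maps (gaussian_measure S\<mu>) (gaussian_measure S\<nu>) \<noteq> {}) \<longrightarrow>
       (\<exists>B :: real^('p::{finite,linorder})^('q::{finite,linorder}).
          is_arg_min (\<lambda>B. - trace (D\<mu> ** transpose B ** D\<nu> ** B))
            (\<lambda>B. transpose B \<in> stiefel) B \<and>
          LGM2_sq (gaussian_measure S\<mu>) (gaussian_measure S\<nu>) =
            ereal (4 * (trace S\<mu> - trace S\<nu>)\<^sup>2 + 8 * (trace (S\<mu> ** S\<mu>) + trace (S\<nu> ** S\<nu>))
              + 16 * (- trace (D\<mu> ** transpose B ** D\<nu> ** B))))) \<and>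
     (invertible S\<mu>' \<longrightarrow>
       V\<nu>' ** matrix_sqrt D\<nu>' ** matrix_inv_sqrt D\<mu>' ** transpose V\<mu>' =
         matrix_sqrt S\<nu>' ** V\<nu>' ** transpose V\<mu>' ** matrix_inv_sqrt S\<mu>' \<and>
       optimal_linear_monge_map (gaussian_measure S\<mu>') (gaussian_measure S\<nu>')
         (\<lambda>x. (V\<nu>' ** matrix_sqrt D\<nu>' ** matrix_inv_sqrt D\<mu>' ** transpose V\<mu>') *v x) \<and>
       LGM2_sq (gaussian_measure S\<mu>') (gaussian_measure S\<nu>') =
         ereal (4 * (trace S\<mu>' - trace S\<nu>')\<^sup>2
           + 8 * (trace (S\<mu>' ** S\<mu>') + trace (S\<nu>' ** S\<nu>'))
           - 16 * trace (D\<mu>' ** D\<nu>')))"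
proof -
  note \<mu> = ordered_diagonalizationD[OF assms(1,3)] and \<nu> = ordered_diagonalizationD[OF assms(2,4)]
  let ?B = "rect_id :: real^('p::{finite,linorder})^('q::{finite,linorder})"
  have arg_min_le: "is_arg_min (\<lambda>B. - trace (D\<mu> ** transpose B ** D\<nu> ** B)) (\<lambda>B. B \<in> stiefel) ?B"
    if "CARD('p) < CARD('q)"
    using that by (intro rect_id_is_arg_min \<mu> \<nu> rect_id_stiefel) auto
  have arg_min_ge: "is_arg_min (\<lambda>B. - trace (D\<mu> ** transpose B ** D\<nu> ** B)) (\<lambda>B. transpose B \<in> stiefel) ?B"
    if "CARD('q) < CARD('p)"
    using that by (intro rect_id_is_arg_min \<mu> \<nu>) (auto simp: transpose_rect_id intro: rect_id_stiefel)
  have LGM: "LGM2_sq (gaussian_measure S\<mu>) (gaussian_measure S\<nu>) =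
      ereal (4 * (trace S\<mu> - trace S\<nu>)\<^sup>2 + 8 * (trace (S\<mu> ** S\<mu>) + trace (S\<nu> ** S\<nu>))
        + 16 * (- trace (D\<mu> ** transpose ?B ** D\<nu> ** ?B)))"
    if "linear_monge_maps (gaussian_measure S\<mu>) (gaussian_measure S\<nu>) \<noteq> {} \<or>
      invertible S\<mu> \<and> CARD('q) < CARD('p)"
  proof -
    have "linear_monge_maps (gaussian_measure S\<mu>) (gaussian_measure S\<nu>) \<noteq> {} \<or>
        invertible S\<mu> \<and> CARD('q) \<le> CARD('p)"
      using that by auto
    note LGM_gaussian(2)[OF assms(1,3,2,4) LGM_gaussian_rank_condition[OF assms(1,3,2,4) this]]
    then show ?thesis by simp
  qed
  have square: "V\<nu>' ** matrix_sqrt D\<nu>' ** matrix_inv_sqrt D\<mu>' ** transpose V\<mu>' =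
         matrix_sqrt S\<nu>' ** V\<nu>' ** transpose V\<mu>' ** matrix_inv_sqrt S\<mu>' \<and>
       optimal_linear_monge_map (gaussian_measure S\<mu>') (gaussian_measure S\<nu>')
         (\<lambda>x. (V\<nu>' ** matrix_sqrt D\<nu>' ** matrix_inv_sqrt D\<mu>' ** transpose V\<mu>') *v x) \<and>
       LGM2_sq (gaussian_measure S\<mu>') (gaussian_measure S\<nu>') =
         ereal (4 * (trace S\<mu>' - trace S\<nu>')\<^sup>2
           + 8 * (trace (S\<mu>' ** S\<mu>') + trace (S\<nu>' ** S\<nu>'))
           - 16 * trace (D\<mu>' ** D\<nu>'))"
    if inv: "invertible S\<mu>'"
  proof -
    note rank = LGM_gaussian_rank_condition[OF assms(5,7,6,8) disjI2[OF conjI[OF inv order_refl]]]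
    note LGM = LGM_gaussian[OF assms(5,7,6,8) rank]
    note mat = square_gaussian_optimal_matrix[OF assms(5,7,6,8) inv]
    show ?thesis
      using LGM by (intro conjI mat(2), simp add: mat(1), simp add: transpose_rect_id rect_id_square)
  qed
  show ?thesis
    by (intro conjI impI exI[of _ ?B]) (use arg_min_le arg_min_ge LGM square in blast)+
qed

end
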